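(* Let $(\phi,\xi,\eta,g)$ be an almost $\alpha$-para-Kenmotsu $(\kappa,\mu,\nu)$-structure on $M^{2n+1}$, and let $(\tilde\phi,\tilde\xi,\tilde\eta,\tilde g)$ be the structure obtained from it by a $D_{\gamma,\beta}$-homothetic deformation. Then $(\tilde\phi,\tilde\xi,\tilde\eta,\tilde g)$ is an almost $\left(\frac{\alpha}{\beta}\right)$-paracosymplectic $(\tilde\kappa,\tilde\mu,\tilde\nu)$-structure, where $$\tilde\kappa=\frac{\kappa}{\beta^2}+\frac{\alpha}{\beta^3}\,d\beta(\xi),\qquad \tilde\mu=\frac{\mu}{\beta},\qquad \tilde\nu=\frac{\nu}{\beta}+\frac{d\beta(\xi)}{\beta^2},$$ and $\tilde\kappa,\tilde\mu,\tilde\nu\in\mathcal{R}_{\tilde\eta}(M^{2n+1})$.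
   Context: An almost paracontact metric manifold is a smooth manifold $M$ of dimension $2n+1$ with a $(1,1)$-tensor field $\phi$, a vector field $\xi$, a 1-form $\eta$ and a pseudo-Riemannian metric $g$ of signature $(n+1,n)$ such that $\eta(\xi)=1$, $\phi^2=\mathrm{Id}-\eta\otimes\xi$, the eigendistributions of $\phi|_{\ker\eta}$ for the eigenvalues $+1$ and $-1$ both have rank $n$, and $g(\phi X,\phi Y)=-g(X,Y)+\eta(X)\eta(Y)$ (hence $\eta(X)=g(X,\xi)$, $\phi\xi=0$, $\eta\circ\phi=0$). Its fundamental 2-form is $\Phi(X,Y)=g(\phi X,Y)$. It is almost $\alpha$-paracosymplectic, where $\alpha$ is a smooth real function on $M$, if $d\eta=0$ and $d\Phi=2\alpha\,\eta\wedge\Phi$ (with $d$ and $\wedge$ normalized compatibly, so that the cyclic sum of $(\nabla_X\Phi)(Y,Z)$ equals $2\alpha$ times the cyclic sum of $\eta(X)\Phi(Y,Z)$); it is almost $\alpha$-para-Kenmotsu if moreover $\alpha$ is constant. $R(X,Y)Z=\nabla_X\nabla_YZ-\nabla_Y\nabla_XZ-\nabla_{[X,Y]}Z$ for the Levi-Civita connection $\nabla$, and $h=\frac12\mathcal{L}_\xi\phi$ (Lie derivative). $\mathcal{R}_\eta(M)$ denotes the set of smooth functions $f$ with $df\wedge\eta=0$. The structure is a $(\kappa,\mu,\nu)$-structure if $\kappa,\mu,\nu\in\mathcal{R}_\eta(M)$ and $R(X,Y)\xi=\eta(Y)BX-\eta(X)BY$ for all $X,Y$, where $B=\kappa\phi^2+\mu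 h+\nu\phi h$ (and likewise for the deformed structure, using $\tilde\nabla$, $\tilde R$, $\tilde h=\frac12\mathcal{L}_{\tilde\xi}\tilde\phi$). For a positive constant $\gamma$ and a nowhere-zero $\beta\in\mathcal{R}_\eta(M)$, the $D_{\gamma,\beta}$-homothetic deformation of $(\phi,\xi,\eta,g)$ is $\tilde\phi=\phi$, $\tilde\xi=\frac1\beta\xi$, $\tilde\eta=\beta\eta$, $\tilde g=\gamma g+(\beta^2-\gamma)\eta\otimes\eta$. *)

theory Defs
  imports "HOL-Analysis.Analysis" "HOL-Library.Function_Algebras"
begin

section \<open>Smooth manifolds\<close>

text \<open>Only meant for open \<open>S\<close>: derivatives are taken \<open>at x\<close>, not \<open>at x within S\<close>.\<close>

primrec Ck_on :: "nat \<Rightarrow> 'e::euclidean_space set \<Rightarrow> ('e \<Rightarrow> 'f::real_normed_vector) \<Rightarrow> bool" where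
  "Ck_on 0 S f \<longleftrightarrow> continuous_on S f"
| "Ck_on (Suc k) S f \<longleftrightarrow>
     (\<forall>x\<in>S. f differentiable (at x)) \<and> (\<forall>v. Ck_on k S (\<lambda>x. frechet_derivative f (at x) v))"

definition smooth_on :: "'e::euclidean_space set \<Rightarrow> ('e \<Rightarrow> 'f::real_normed_vector) \<Rightarrow> bool" where
  "smooth_on S f \<longleftrightarrow> (\<forall>k. Ck_on k S f)"

text \<open>The underlying set of the manifold is the whole type \<open>'a\<close>; the dimension is \<open>DIM('e)\<close>.
  A chart is given by its domain and its coordinate map.\<close>

type_synonym ('a, 'e) atlas = "('a set \<times> ('a \<Rightarrow> 'e)) set"

definition smooth_atlas ::
    "('a::{t2_space,second_countable_topology}, 'e::euclidean_space) atlas \<Rightarrow> bool" where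
  "smooth_atlas A \<longleftrightarrow>
     (\<Union>(U, c)\<in>A. U) = UNIV \<and>
     (\<forall>(U, c)\<in>A. open U \<and> open (c ` U) \<and> homeomorphism U (c ` U) c (inv_into U c)) \<and>
     (\<forall>(U, c)\<in>A. \<forall>(V, d)\<in>A. smooth_on (c ` (U \<inter> V)) (d \<circ> inv_into U c))"

definition smooth_funs :: "('a, 'e::euclidean_space) atlas \<Rightarrow> ('a \<Rightarrow> real) set" where
  "smooth_funs A = {f. \<forall>(U, c)\<in>A. smooth_on (c ` U) (f \<circ> inv_into U c)}"


section \<open>Tangent vectors and tensor fields\<close>

text \<open>Tangent vectors at \<open>p\<close> are the derivations at \<open>p\<close> of the algebra of smooth functions.
  They are set to \<open>0\<close> on non-smooth functions, so that equality of derivations is equality in HOL.\<close>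

type_synonym 'a tvec = "('a \<Rightarrow> real) \<Rightarrow> real"
type_synonym 'a vfield = "'a \<Rightarrow> 'a tvec"
type_synonym 'a oneform = "'a \<Rightarrow> 'a tvec \<Rightarrow> real"
type_synonym 'a endo = "'a \<Rightarrow> 'a tvec \<Rightarrow> 'a tvec"
type_synonym 'a bilin = "'a \<Rightarrow> 'a tvec \<Rightarrow> 'a tvec \<Rightarrow> real"

definition tscale :: "real \<Rightarrow> 'a tvec \<Rightarrow> 'a tvec"  (infixr "*\<^sub>T" 75) where
  "r *\<^sub>T v = (\<lambda>f. r * v f)"

interpretation tv: vector_space "tscale :: real \<Rightarrow> 'a tvec \<Rightarrow> 'a tvec"
  by standard (auto simp: tscale_def fun_eq_iff algebra_simps)

definition tangent_space :: "('a, 'e::euclidean_space) atlas \<Rightarrow> 'a \<Rightarrow> 'a tvec set" where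
  "tangent_space A p = {v.
     (\<forall>f\<in>smooth_funs A. \<forall>g\<in>smooth_funs A. v (f + g) = v f + v g) \<and>
     (\<forall>r. \<forall>f\<in>smooth_funs A. v (\<lambda>x. r * f x) = r * v f) \<and>
     (\<forall>f\<in>smooth_funs A. \<forall>g\<in>smooth_funs A. v (f * g) = f p * v g + g p * v f) \<and>
     (\<forall>f. f \<notin> smooth_funs A \<longrightarrow> v f = 0)}"

definition vfields :: "('a, 'e::euclidean_space) atlas \<Rightarrow> 'a vfield set" where
  "vfields A = {X. (\<forall>p. X p \<in> tangent_space A p) \<and>
                   (\<forall>f\<in>smooth_funs A. (\<lambda>p. X p f) \<in> smooth_funs A)}"

definition fscale :: "('a \<Rightarrow> real) \<Rightarrow> 'a vfield \<Rightarrow> 'a vfield"  (infixr "*\<^sub>F" 75) where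
  "f *\<^sub>F X = (\<lambda>p. f p *\<^sub>T X p)"

definition deriv_along :: "'a vfield \<Rightarrow> ('a \<Rightarrow> real) \<Rightarrow> 'a \<Rightarrow> real" where
  "deriv_along X f = (\<lambda>p. X p f)"

definition app1 :: "'a oneform \<Rightarrow> 'a vfield \<Rightarrow> 'a \<Rightarrow> real" where
  "app1 \<omega> X = (\<lambda>p. \<omega> p (X p))"

definition appE :: "'a endo \<Rightarrow> 'a vfield \<Rightarrow> 'a vfield" where
  "appE T X = (\<lambda>p. T p (X p))"

definition app2 :: "'a bilin \<Rightarrow> 'a vfield \<Rightarrow> 'a vfield \<Rightarrow> 'a \<Rightarrow> real" where
  "app2 b X Y = (\<lambda>p. b p (X p) (Y p))"

text \<open>Tensor fields are families of linear maps on the tangent spaces (values on other arguments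
  are irrelevant); they are smooth iff they map smooth vector fields to smooth objects.\<close>

definition oneform :: "('a, 'e::euclidean_space) atlas \<Rightarrow> 'a oneform \<Rightarrow> bool" where
  "oneform A \<omega> \<longleftrightarrow>
     (\<forall>p. \<forall>v\<in>tangent_space A p. \<forall>w\<in>tangent_space A p. \<forall>r.
        \<omega> p (v + w) = \<omega> p v + \<omega> p w \<and> \<omega> p (r *\<^sub>T v) = r * \<omega> p v) \<and>
     (\<forall>X\<in>vfields A. app1 \<omega> X \<in> smooth_funs A)"

definition endo_field :: "('a, 'e::euclidean_space) atlas \<Rightarrow> 'a endo \<Rightarrow> bool" where
  "endo_field A T \<longleftrightarrow>
     (\<forall>p. \<forall>v\<in>tangent_space A p. T p v \<in> tangent_space A p) \<and>
     (\<forall>p. \<forall>v\<in>tangent_space A p. \<forall>w\<in>tangent_space A p. \<forall>r.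
        T p (v + w) = T p v + T p w \<and> T p (r *\<^sub>T v) = r *\<^sub>T T p v) \<and>
     (\<forall>X\<in>vfields A. appE T X \<in> vfields A)"

definition bilin_field :: "('a, 'e::euclidean_space) atlas \<Rightarrow> 'a bilin \<Rightarrow> bool" where
  "bilin_field A b \<longleftrightarrow>
     (\<forall>p. \<forall>u\<in>tangent_space A p. \<forall>v\<in>tangent_space A p. \<forall>w\<in>tangent_space A p. \<forall>r.
        b p (u + v) w = b p u w + b p v w \<and> b p (r *\<^sub>T u) w = r * b p u w \<and>
        b p w (u + v) = b p w u + b p w v \<and> b p w (r *\<^sub>T u) = r * b p w u) \<and>
     (\<forall>X\<in>vfields A. \<forall>Y\<in>vfields A. app2 b X Y \<in> smooth_funs A)"

definition pseudo_riemannian_metric ::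
    "('a, 'e::euclidean_space) atlas \<Rightarrow> nat \<Rightarrow> nat \<Rightarrow> 'a bilin \<Rightarrow> bool" where
  "pseudo_riemannian_metric A k l g \<longleftrightarrow>
     bilin_field A g \<and>
     (\<forall>p. \<forall>v\<in>tangent_space A p. \<forall>w\<in>tangent_space A p. g p v w = g p w v) \<and>
     (\<forall>p. \<exists>e. inj_on e {..<k + l} \<and> tv.independent (e ` {..<k + l}) \<and>
        tv.span (e ` {..<k + l}) = tangent_space A p \<and>
        (\<forall>i<k + l. \<forall>j<k + l. g p (e i) (e j) = (if i = j then (if i < k then 1 else -1) else 0)))"


section \<open>Brackets, exterior derivatives, connections\<close>

definition lie_bracket :: "'a vfield \<Rightarrow> 'a vfield \<Rightarrow> 'a vfield" where
  "lie_bracket X Y = (\<lambda>p f. X p (deriv_along Y f) - Y p (deriv_along X f))"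

definition lie_deriv_endo :: "'a vfield \<Rightarrow> 'a endo \<Rightarrow> 'a vfield \<Rightarrow> 'a vfield" where
  "lie_deriv_endo X T Y = lie_bracket X (appE T Y) - appE T (lie_bracket X Y)"

definition d0 :: "('a \<Rightarrow> real) \<Rightarrow> 'a oneform" where
  "d0 f = (\<lambda>p v. v f)"

definition wedge11 :: "'a oneform \<Rightarrow> 'a oneform \<Rightarrow> 'a bilin" where
  "wedge11 \<omega> \<theta> = (\<lambda>p v w. \<omega> p v * \<theta> p w - \<omega> p w * \<theta> p v)"

text \<open>Cartan's formulas, with the normalization without factors \<open>1/2\<close> and \<open>1/3\<close>, and
  the compatible wedge product.\<close>

definition d1 :: "'a oneform \<Rightarrow> 'a vfield \<Rightarrow> 'a vfield \<Rightarrow> 'a \<Rightarrow> real" where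
  "d1 \<omega> X Y = deriv_along X (app1 \<omega> Y) - deriv_along Y (app1 \<omega> X) - app1 \<omega> (lie_bracket X Y)"

definition d2 :: "'a bilin \<Rightarrow> 'a vfield \<Rightarrow> 'a vfield \<Rightarrow> 'a vfield \<Rightarrow> 'a \<Rightarrow> real" where
  "d2 b X Y Z =
     deriv_along X (app2 b Y Z) + deriv_along Y (app2 b Z X) + deriv_along Z (app2 b X Y)
     - app2 b (lie_bracket X Y) Z - app2 b (lie_bracket Y Z) X - app2 b (lie_bracket Z X) Y"

definition wedge12 ::
    "'a oneform \<Rightarrow> 'a bilin \<Rightarrow> 'a vfield \<Rightarrow> 'a vfield \<Rightarrow> 'a vfield \<Rightarrow> 'a \<Rightarrow> real" where
  "wedge12 \<omega> b X Y Z =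
     app1 \<omega> X * app2 b Y Z + app1 \<omega> Y * app2 b Z X + app1 \<omega> Z * app2 b X Y"

type_synonym 'a connection = "'a vfield \<Rightarrow> 'a vfield \<Rightarrow> 'a vfield"

text \<open>\<open>D X Y\<close> is the covariant derivative of \<open>Y\<close> along \<open>X\<close>.\<close>

definition affine_connection ::
    "('a, 'e::euclidean_space) atlas \<Rightarrow> 'a connection \<Rightarrow> bool" where
  "affine_connection A D \<longleftrightarrow>
     (\<forall>X\<in>vfields A. \<forall>Y\<in>vfields A. D X Y \<in> vfields A) \<and>
     (\<forall>X\<in>vfields A. \<forall>Y\<in>vfields A. \<forall>Z\<in>vfields A.
        D (X + Y) Z = D X Z + D Y Z \<and> D X (Y + Z) = D X Y + D X Z) \<and>
     (\<forall>f\<in>smooth_funs A. \<forall>X\<in>vfields A. \<forall>Y\<in>vfields A.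
        D (f *\<^sub>F X) Y = f *\<^sub>F D X Y \<and>
        D X (f *\<^sub>F Y) = deriv_along X f *\<^sub>F Y + f *\<^sub>F D X Y)"

definition levi_civita ::
    "('a, 'e::euclidean_space) atlas \<Rightarrow> 'a bilin \<Rightarrow> 'a connection \<Rightarrow> bool" where
  "levi_civita A g D \<longleftrightarrow>
     affine_connection A D \<and>
     (\<forall>X\<in>vfields A. \<forall>Y\<in>vfields A. D X Y - D Y X = lie_bracket X Y) \<and>
     (\<forall>X\<in>vfields A. \<forall>Y\<in>vfields A. \<forall>Z\<in>vfields A.
        deriv_along X (app2 g Y Z) = app2 g (D X Y) Z + app2 g Y (D X Z))"

definition curvature ::
    "'a connection \<Rightarrow> 'a vfield \<Rightarrow> 'a vfield \<Rightarrow> 'a vfield \<Rightarrow> 'a vfield" where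
  "curvature D X Y Z = D X (D Y Z) - D Y (D X Z) - D (lie_bracket X Y) Z"


section \<open>Almost paracontact metric structures\<close>

definition almost_paracontact_metric ::
    "('a, 'e::euclidean_space) atlas \<Rightarrow> nat \<Rightarrow> 'a endo \<Rightarrow> 'a vfield \<Rightarrow> 'a oneform \<Rightarrow> 'a bilin \<Rightarrow> bool"
  where
  "almost_paracontact_metric A n \<phi> \<xi> \<eta> g \<longleftrightarrow>
     DIM('e) = 2 * n + 1 \<and>
     endo_field A \<phi> \<and> \<xi> \<in> vfields A \<and> oneform A \<eta> \<and>
     pseudo_riemannian_metric A (n + 1) n g \<and>
     (\<forall>p. \<eta> p (\<xi> p) = 1) \<and>
     (\<forall>p. \<forall>v\<in>tangent_space A p. \<phi> p (\<phi> p v) = v - \<eta> p v *\<^sub>T \<xi> p) \<and>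
     (\<forall>p. tv.dim {v \<in> tangent_space A p. \<eta> p v = 0 \<and> \<phi> p v = v} = n \<and>
          tv.dim {v \<in> tangent_space A p. \<eta> p v = 0 \<and> \<phi> p v = - v} = n) \<and>
     (\<forall>p. \<forall>v\<in>tangent_space A p. \<forall>w\<in>tangent_space A p.
        g p (\<phi> p v) (\<phi> p w) = - g p v w + \<eta> p v * \<eta> p w)"

definition fundamental_form :: "'a endo \<Rightarrow> 'a bilin \<Rightarrow> 'a bilin" where
  "fundamental_form \<phi> g = (\<lambda>p v w. g p (\<phi> p v) w)"

definition almost_paracosymplectic ::
    "('a, 'e::euclidean_space) atlas \<Rightarrow> nat \<Rightarrow> ('a \<Rightarrow> real) \<Rightarrow>
      'a endo \<Rightarrow> 'a vfield \<Rightarrow> 'a oneform \<Rightarrow> 'a bilin \<Rightarrow> bool" where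
  "almost_paracosymplectic A n \<alpha> \<phi> \<xi> \<eta> g \<longleftrightarrow>
     almost_paracontact_metric A n \<phi> \<xi> \<eta> g \<and>
     \<alpha> \<in> smooth_funs A \<and>
     (\<forall>X\<in>vfields A. \<forall>Y\<in>vfields A. d1 \<eta> X Y = 0) \<and>
     (\<forall>X\<in>vfields A. \<forall>Y\<in>vfields A. \<forall>Z\<in>vfields A.
        d2 (fundamental_form \<phi> g) X Y Z = 2 * \<alpha> * wedge12 \<eta> (fundamental_form \<phi> g) X Y Z)"

definition almost_para_kenmotsu ::
    "('a, 'e::euclidean_space) atlas \<Rightarrow> nat \<Rightarrow> ('a \<Rightarrow> real) \<Rightarrow>
      'a endo \<Rightarrow> 'a vfield \<Rightarrow> 'a oneform \<Rightarrow> 'a bilin \<Rightarrow> bool" where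
  "almost_para_kenmotsu A n \<alpha> \<phi> \<xi> \<eta> g \<longleftrightarrow>
     almost_paracosymplectic A n \<alpha> \<phi> \<xi> \<eta> g \<and> (\<exists>c. \<forall>p. \<alpha> p = c)"

definition h_op :: "'a endo \<Rightarrow> 'a vfield \<Rightarrow> 'a vfield \<Rightarrow> 'a vfield" where
  "h_op \<phi> \<xi> X = (\<lambda>_. 1 / 2) *\<^sub>F lie_deriv_endo \<xi> \<phi> X"

definition R_class :: "('a, 'e::euclidean_space) atlas \<Rightarrow> 'a oneform \<Rightarrow> ('a \<Rightarrow> real) set" where
  "R_class A \<eta> = {f \<in> smooth_funs A.
     \<forall>p. \<forall>v\<in>tangent_space A p. \<forall>w\<in>tangent_space A p. wedge11 (d0 f) \<eta> p v w = 0}"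

definition B_op :: "'a endo \<Rightarrow> 'a vfield \<Rightarrow> ('a \<Rightarrow> real) \<Rightarrow> ('a \<Rightarrow> real) \<Rightarrow> ('a \<Rightarrow> real) \<Rightarrow>
    'a vfield \<Rightarrow> 'a vfield" where
  "B_op \<phi> \<xi> \<kappa> \<mu> \<nu> X =
     \<kappa> *\<^sub>F appE \<phi> (appE \<phi> X) + \<mu> *\<^sub>F h_op \<phi> \<xi> X + \<nu> *\<^sub>F appE \<phi> (h_op \<phi> \<xi> X)"

text \<open>By the fundamental theorem of pseudo-Riemannian geometry the connection \<open>D\<close> exists and is
  unique (as a map on smooth vector fields), so the existential quantifier just names it.\<close>

definition kmn_structure ::
    "('a, 'e::euclidean_space) atlas \<Rightarrow> 'a endo \<Rightarrow> 'a vfield \<Rightarrow> 'a oneform \<Rightarrow> 'a bilin \<Rightarrow>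
      ('a \<Rightarrow> real) \<Rightarrow> ('a \<Rightarrow> real) \<Rightarrow> ('a \<Rightarrow> real) \<Rightarrow> bool" where
  "kmn_structure A \<phi> \<xi> \<eta> g \<kappa> \<mu> \<nu> \<longleftrightarrow>
     \<kappa> \<in> R_class A \<eta> \<and> \<mu> \<in> R_class A \<eta> \<and> \<nu> \<in> R_class A \<eta> \<and>
     (\<exists>D. levi_civita A g D \<and>
        (\<forall>X\<in>vfields A. \<forall>Y\<in>vfields A.
           curvature D X Y \<xi> =
             app1 \<eta> Y *\<^sub>F B_op \<phi> \<xi> \<kappa> \<mu> \<nu> X - app1 \<eta> X *\<^sub>F B_op \<phi> \<xi> \<kappa> \<mu> \<nu> Y))"


section \<open>Homothetic deformations\<close>

text \<open>The deformation leaves \<open>\<phi>\<close> unchanged.\<close>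

definition deform_xi :: "('a \<Rightarrow> real) \<Rightarrow> 'a vfield \<Rightarrow> 'a vfield" where
  "deform_xi \<beta> \<xi> = (\<lambda>p. 1 / \<beta> p) *\<^sub>F \<xi>"

definition deform_eta :: "('a \<Rightarrow> real) \<Rightarrow> 'a oneform \<Rightarrow> 'a oneform" where
  "deform_eta \<beta> \<eta> = (\<lambda>p v. \<beta> p * \<eta> p v)"

definition deform_g :: "real \<Rightarrow> ('a \<Rightarrow> real) \<Rightarrow> 'a oneform \<Rightarrow> 'a bilin \<Rightarrow> 'a bilin" where
  "deform_g \<gamma> \<beta> \<eta> g = (\<lambda>p v w. \<gamma> * g p v w + ((\<beta> p)\<^sup>2 - \<gamma>) * \<eta> p v * \<eta> p w)"

end

theory Submission
  imports Defs
begin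

text \<open>Since \<open>d\<eta> = 0\<close> and \<open>d\<beta>\<close> is proportional to \<open>\<eta>\<close>, the Koszul formula shows that the Levi-Civita
  connections of \<open>g\<close> and \<open>g'\<close> differ only by a multiple of \<open>\<xi>\<close>:
  \<open>D' X Y = D X Y + ((\<xi> \<beta> / \<beta>) (\<eta> X) (\<eta> Y) + (1 - \<gamma> / \<beta>\<^sup>2) g(D X \<xi>, Y)) \<xi>\<close> (lemma \<open>levi_civita_D'\<close>).
  This gives \<open>D' X \<xi>' = (1 / \<beta>) D X \<xi>\<close> (lemma \<open>D'_xi'\<close>). In the curvature the change of connection
  disappears by symmetry, and
  \<open>R'(X, Y) \<xi>' = (1 / \<beta>) R(X, Y) \<xi> + (\<xi> \<beta> / \<beta>\<^sup>2) ((\<eta> Y) D X \<xi> - (\<eta> X) D Y \<xi>)\<close> (lemma \<open>curvature_D'_xi'\<close>).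
  The condition \<open>d\<Phi> = 2 \<alpha> \<eta> \<and> \<Phi>\<close>, evaluated with \<open>\<xi>\<close> in one argument, yields
  \<open>D X \<xi> = \<alpha> \<phi>\<^sup>2 X + \<phi> h X\<close> (lemma \<open>D_xi\<close>). Therefore the last term has the same shape as the given
  curvature, and contributes \<open>\<alpha> (\<xi> \<beta>) / \<beta>\<^sup>3\<close> to \<open>\<kappa>\<close> and \<open>(\<xi> \<beta>) / \<beta>\<^sup>2\<close> to \<open>\<nu>\<close>, as \<open>h' = h / \<beta>\<close>.\<close>

text \<open>Two of these steps pass from identities between global vector fields to identities at a point: to
  drop the test field \<open>Z\<close> from \<open>g(X, Z) = g(Y, Z)\<close>, and to show that \<open>\<xi> \<beta>\<close> is again in \<open>R\<^sub>\<eta>\<close>. Both need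
  every tangent vector to extend to a smooth vector field (lemma \<open>tangent_extend\<close>). Locally the
  extension has constant coefficients in a chart, and a smooth bump function makes it global; this is
  why smoothness on a manifold has to be developed from the calculus of iterated derivatives.\<close>

section \<open>Calculus of smooth maps\<close>

lemma Ck_on_cong:
  assumes "open S" "\<And>x. x \<in> S \<Longrightarrow> f x = g x" "Ck_on k S f"
  shows "Ck_on k S g"
  using assms(2,3)
proof (induction k arbitrary: f g)
  case 0
  then show ?case using continuous_on_cong by force
next
  case (Suc k)
  have g: "(g has_derivative frechet_derivative f (at x)) (at x)" if "x \<in> S" for x
  proof -
    have "(f has_derivative frechet_derivative f (at x)) (at x)"
      using Suc.prems that by (simp add: frechet_derivative_works)
    then show ?thesis
      using has_derivative_transform_within_open \<open>open S\<close> that Suc.prems(1) by blast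
  qed
  then have "frechet_derivative f (at x) v = frechet_derivative g (at x) v" if "x \<in> S" for x v
    using that frechet_derivative_at by metis
  then have "Ck_on k S (\<lambda>x. frechet_derivative g (at x) v)" for v
    using Suc.IH[of "\<lambda>x. frechet_derivative f (at x) v"] Suc.prems(2) by simp
  then show ?case
    using g by (auto simp: differentiable_def)
qed

text \<open>Frees the recursion from \<^const>\<open>frechet_derivative\<close>: any pointwise derivative may serve, so the
  usual rules for \<^const>\<open>has_derivative\<close> apply directly.\<close>

lemma Ck_on_Suc_iff:
  assumes "open S"
  shows "Ck_on (Suc k) S f \<longleftrightarrow>
    (\<exists>f'. (\<forall>x\<in>S. (f has_derivative f' x) (at x)) \<and> (\<forall>v. Ck_on k S (\<lambda>x. f' x v)))"
proof
  assume "Ck_on (Suc k) S f"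
  then show "\<exists>f'. (\<forall>x\<in>S. (f has_derivative f' x) (at x)) \<and> (\<forall>v. Ck_on k S (\<lambda>x. f' x v))"
    by (intro exI[of _ "\<lambda>x. frechet_derivative f (at x)"]) (simp add: frechet_derivative_works)
next
  assume "\<exists>f'. (\<forall>x\<in>S. (f has_derivative f' x) (at x)) \<and> (\<forall>v. Ck_on k S (\<lambda>x. f' x v))"
  then obtain f' where f': "\<And>x. x \<in> S \<Longrightarrow> (f has_derivative f' x) (at x)" "\<And>v. Ck_on k S (\<lambda>x. f' x v)"
    by blast
  then have "Ck_on k S (\<lambda>x. frechet_derivative f (at x) v)" for v
    by (intro Ck_on_cong[OF assms _ f'(2)[of v]]) (metis f'(1) frechet_derivative_at)
  then show "Ck_on (Suc k) S f"
    using f'(1) by (auto simp: differentiable_def)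
qed

lemma Ck_on_SucD:
  assumes "Ck_on (Suc k) S f"
  shows "Ck_on k S f"
  using assms
proof (induction k arbitrary: f)
  case 0
  then show ?case
    by (auto intro!: continuous_at_imp_continuous_on differentiable_imp_continuous_within)
qed auto

lemma Ck_on_const: "open S \<Longrightarrow> Ck_on k S (\<lambda>x. c)"
  by (induction k arbitrary: c) auto

lemma Ck_on_linear:
  assumes "bounded_linear f" and "open S" "Ck_on k S g"
  shows "Ck_on k S (\<lambda>x. f (g x))"
  using assms(3)
proof (induction k arbitrary: g)
  case 0
  then show ?case by (auto intro: bounded_linear.continuous_on[OF assms(1)])
next
  case (Suc k)
  then obtain g' where "\<And>x. x \<in> S \<Longrightarrow> (g has_derivative g' x) (at x)" "\<And>v. Ck_on k S (\<lambda>x. g' x v)"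
    unfolding Ck_on_Suc_iff[OF assms(2)] by blast
  then show ?case
    unfolding Ck_on_Suc_iff[OF assms(2)] using Suc.IH
    by (intro exI[of _ "\<lambda>x v. f (g' x v)"]) (auto intro: bounded_linear.has_derivative[OF assms(1)])
qed

lemma Ck_on_add:
  assumes "open S" "Ck_on k S f" "Ck_on k S g"
  shows "Ck_on k S (\<lambda>x. f x + g x)"
  using assms(2,3)
proof (induction k arbitrary: f g)
  case 0
  then show ?case by (auto intro: continuous_on_add)
next
  case (Suc k)
  then obtain f' g' where
    "\<And>x. x \<in> S \<Longrightarrow> (f has_derivative f' x) (at x)" "\<And>v. Ck_on k S (\<lambda>x. f' x v)"
    "\<And>x. x \<in> S \<Longrightarrow> (g has_derivative g' x) (at x)" "\<And>v. Ck_on k S (\<lambda>x. g' x v)"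
    unfolding Ck_on_Suc_iff[OF assms(1)] by blast
  then show ?case
    unfolding Ck_on_Suc_iff[OF assms(1)] using Suc.IH
    by (intro exI[of _ "\<lambda>x v. f' x v + g' x v"]) (auto intro: has_derivative_add)
qed

lemma Ck_on_sum:
  assumes "open S" "\<And>i. i \<in> I \<Longrightarrow> Ck_on k S (f i)"
  shows "Ck_on k S (\<lambda>x. \<Sum>i\<in>I. f i x)"
  using assms(2)
  by (induction I rule: infinite_finite_induct) (auto intro: Ck_on_const Ck_on_add assms(1))

lemma Ck_on_bilinear:
  assumes "bounded_bilinear B" and "open S" "Ck_on k S f" "Ck_on k S g"
  shows "Ck_on k S (\<lambda>x. B (f x) (g x))"
  using assms(3,4)
proof (induction k arbitrary: f g)
  case 0
  then show ?case by (auto intro: bounded_bilinear.continuous_on[OF assms(1)])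
next
  case (Suc k)
  then obtain f' g' where d:
    "\<And>x. x \<in> S \<Longrightarrow> (f has_derivative f' x) (at x)" "\<And>v. Ck_on k S (\<lambda>x. f' x v)"
    "\<And>x. x \<in> S \<Longrightarrow> (g has_derivative g' x) (at x)" "\<And>v. Ck_on k S (\<lambda>x. g' x v)"
    unfolding Ck_on_Suc_iff[OF assms(2)] by blast
  have "Ck_on k S f" "Ck_on k S g"
    using Suc.prems by (auto intro: Ck_on_SucD simp del: Ck_on.simps)
  then show ?case
    unfolding Ck_on_Suc_iff[OF assms(2)] using d Suc.IH
    by (intro exI[of _ "\<lambda>x v. B (f x) (g' x v) + B (f' x v) (g x)"])
       (auto intro!: bounded_bilinear.FDERIV[OF assms(1)] Ck_on_add[OF assms(2)])
qed

text \<open>The derivative of \<open>f \<circ> g\<close> is expanded in a basis, \<open>D(f \<circ> g) v = \<Sum>i. (Dg v \<bullet> i) * (D\<^sub>i f \<circ> g)\<close>,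
  because the inductive hypothesis only speaks of the directional derivatives of \<open>f\<close> in fixed
  directions.\<close>

lemma Ck_on_compose:
  fixes f :: "'b::euclidean_space \<Rightarrow> 'c::real_normed_vector" and g :: "'a::euclidean_space \<Rightarrow> 'b"
  assumes "open S" "open T" "g ` S \<subseteq> T" "Ck_on k T f" "Ck_on k S g"
  shows "Ck_on k S (\<lambda>x. f (g x))"
  using assms(4,5)
proof (induction k arbitrary: f)
  case 0
  then show ?case using assms(3) by (auto intro: continuous_on_compose2)
next
  case (Suc k)
  then obtain f' g' where d:
    "\<And>x. x \<in> T \<Longrightarrow> (f has_derivative f' x) (at x)" "\<And>v. Ck_on k T (\<lambda>x. f' x v)"
    "\<And>x. x \<in> S \<Longrightarrow> (g has_derivative g' x) (at x)" "\<And>v. Ck_on k S (\<lambda>x. g' x v)"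
    unfolding Ck_on_Suc_iff[OF assms(1)] Ck_on_Suc_iff[OF assms(2)] by blast
  let ?h = "\<lambda>x v. \<Sum>i\<in>Basis. (g' x v \<bullet> i) *\<^sub>R f' (g x) i"
  have "((\<lambda>x. f (g x)) has_derivative ?h x) (at x)" if "x \<in> S" for x
  proof -
    have f': "(f has_derivative f' (g x)) (at (g x))"
      using d(1) that assms(3) by blast
    then interpret linear "f' (g x)"
      by (rule has_derivative_linear)
    have "?h x v = f' (g x) (g' x v)" for v
      using euclidean_representation[of "g' x v"] by (metis (no_types, lifting) scale sum sum.cong)
    then show ?thesis
      using has_derivative_compose[OF d(3)[OF that] f'] by simp
  qed
  moreover have "Ck_on k S (\<lambda>x. ?h x v)" for v
    using Suc.IH[OF d(2) Ck_on_SucD[OF Suc.prems(2)]] assms(1) d(4)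
    by (intro Ck_on_sum Ck_on_bilinear[OF bounded_bilinear_scaleR]
        Ck_on_linear[OF bounded_linear_inner_left]) auto
  ultimately show ?case
    unfolding Ck_on_Suc_iff[OF assms(1)] by (intro exI[of _ ?h]) blast
qed

lemma Ck_on_Un:
  assumes "open S" "open T" "Ck_on k S f" "Ck_on k T f"
  shows "Ck_on k (S \<union> T) f"
  using assms(3,4)
  by (induction k arbitrary: f) (auto intro: continuous_on_open_Un assms)

lemma Ck_on_id: "open S \<Longrightarrow> Ck_on k S (\<lambda>x. x)"
  by (cases k) (auto simp: Ck_on_Suc_iff intro!: exI[of _ "\<lambda>x v. v"] Ck_on_const continuous_on_id)

lemma Ck_on_inverse: "Ck_on k (- {0}) (inverse :: real \<Rightarrow> real)"
proof (induction k)
  case 0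
  then show ?case by (auto intro!: continuous_intros)
next
  case (Suc k)
  have "open (- {0::real})" by auto
  then show ?case
    using Suc unfolding Ck_on_Suc_iff[OF \<open>open (- {0::real})\<close>]
    by (intro exI[of _ "\<lambda>x v. - (inverse x * v * inverse x)"])
       (auto intro!: has_derivative_inverse' Ck_on_linear[OF bounded_linear_minus[OF bounded_linear_ident]]
         Ck_on_bilinear[OF bounded_bilinear_mult] Ck_on_const)
qed

lemma smooth_onD:
  assumes "smooth_on S f" "x \<in> S"
  shows "f differentiable (at x)" and "smooth_on S (\<lambda>x. frechet_derivative f (at x) v)"
proof -
  have "Ck_on (Suc k) S f" for k
    using assms(1) by (auto simp: smooth_on_def)
  then show "f differentiable (at x)" "smooth_on S (\<lambda>x. frechet_derivative f (at x) v)"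
    using assms(2) by (auto simp: smooth_on_def)
qed


section \<open>Bump functions\<close>

text \<open>The derivative of \<open>flat k\<close> is \<open>flat (k + 2) - k * flat (k + 1)\<close>, also at \<open>0\<close>; keeping \<open>k\<close>
  general is what makes the induction over the order of differentiability go through.\<close>

definition flat :: "nat \<Rightarrow> real \<Rightarrow> real" where
  "flat k t = (if t > 0 then exp (- 1 / t) / t ^ k else 0)"

lemma has_derivative_flat:
  "(flat k has_real_derivative flat (k + 2) t - of_nat k * flat (k + 1) t) (at t)"
proof (cases t "0::real" rule: linorder_cases)
  case less
  have "((\<lambda>_. 0) has_real_derivative 0) (at t)" by simp
  then have "(flat k has_real_derivative 0) (at t)"
    by (rule DERIV_cong_ev[THEN iffD1, rotated -1])
       (use less in \<open>auto simp: flat_def eventually_nhds intro!: exI[of _ "{..<0}"]\<close>)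
  then show ?thesis using less by (simp add: flat_def)
next
  case equal
  have "((\<lambda>h. flat k h / h) \<longlongrightarrow> 0) (at 0)"
  proof (rule filterlim_split_at)
    show "((\<lambda>h. flat k h / h) \<longlongrightarrow> 0) (at_left 0)"
      by (rule tendsto_eventually) (auto simp: flat_def eventually_at_filter)
    have "((\<lambda>h. inverse h ^ Suc k / exp (inverse h)) \<longlongrightarrow> 0) (at_right (0::real))"
      by (rule filterlim_compose[OF tendsto_power_div_exp_0 filterlim_inverse_at_top_right])
    then show "((\<lambda>h. flat k h / h) \<longlongrightarrow> 0) (at_right 0)"
      by (rule tendsto_cong[THEN iffD1, rotated])
         (auto simp: flat_def eventually_at_filter exp_minus divide_simps power_divide)
  qed
  then show ?thesis
    using equal by (simp add: DERIV_def flat_def)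
next
  case greater
  have "((\<lambda>t. exp (- 1 / t) / t ^ k) has_real_derivative
      exp (- 1 / t) / t ^ (k + 2) - of_nat k * (exp (- 1 / t) / t ^ (k + 1))) (at t)"
  proof -
    have k: "of_nat k * t ^ (k - 1) = of_nat k * t ^ k / t"
      using greater by (cases k) auto
    have d: "((\<lambda>t. exp (- 1 / t)) has_real_derivative exp (- 1 / t) / t\<^sup>2) (at t)"
      using greater by (auto intro!: derivative_eq_intros simp: power2_eq_square)
    have q: "(exp (- 1 / t) / t\<^sup>2 * t ^ k - exp (- 1 / t) * (of_nat k * t ^ (k - 1))) / (t ^ k * t ^ k)
        = exp (- 1 / t) / t ^ (k + 2) - of_nat k * (exp (- 1 / t) / t ^ (k + 1))"
      unfolding k using greater by (simp add: field_simps power2_eq_square)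
    show ?thesis
      using DERIV_divide[OF d DERIV_pow[of k t]] greater q by simp
  qed
  then have "(flat k has_real_derivative
      exp (- 1 / t) / t ^ (k + 2) - of_nat k * (exp (- 1 / t) / t ^ (k + 1))) (at t)"
    by (rule DERIV_cong_ev[THEN iffD1, rotated -1])
       (use greater in \<open>auto simp: flat_def eventually_nhds intro!: exI[of _ "{0<..}"]\<close>)
  then show ?thesis using greater by (simp add: flat_def)
qed

lemma Ck_on_flat: "Ck_on m UNIV (flat k)"
proof (induction m arbitrary: k)
  case 0
  show ?case
    using has_derivative_flat by (auto intro!: DERIV_isCont continuous_at_imp_continuous_on)
next
  case (Suc m)
  let ?d = "\<lambda>t. flat (k + 2) t + - of_nat k * flat (k + 1) t"
  have "(flat k has_derivative (\<lambda>v. ?d t * v)) (at t)" for t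
    using has_derivative_flat[of k t] by (simp add: has_field_derivative_def)
  moreover have "Ck_on m UNIV (\<lambda>t. ?d t * v)" for v
    by (intro Ck_on_bilinear[OF bounded_bilinear_mult] Ck_on_add Ck_on_const Suc.IH open_UNIV)
  ultimately show ?case
    unfolding Ck_on_Suc_iff[OF open_UNIV] by (intro exI[of _ "\<lambda>t v. ?d t * v"]) blast
qed


section \<open>Tangent vectors and linear algebra\<close>

lemma tscale_apply [simp]: "(r *\<^sub>T v) f = r * v f"
  by (simp add: tscale_def)

lemma fscale_apply [simp]: "(f *\<^sub>F X) p = f p *\<^sub>T X p"
  by (simp add: fscale_def)

lemma appE_apply [simp]: "appE S X p = S p (X p)"
  by (simp add: appE_def)

text \<open>Lets independent families of the right size span a tangent space although the surrounding space
  of all functionals has infinite dimension: an outside vector could be added to \<open>C\<close>, giving too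
  many independent vectors in the span of \<open>E\<close>.\<close>

lemma span_subset_span_if_card_eq:
  assumes E: "finite E" and C: "tv.independent C" "C \<subseteq> tv.span E" "finite C" "card C = card E"
  shows "tv.span E \<subseteq> tv.span C"
proof (rule ccontr)
  assume "\<not> tv.span E \<subseteq> tv.span C"
  then obtain w where w: "w \<in> tv.span E" "w \<notin> tv.span C"
    by blast
  have "tv.independent (insert w C)"
    by (rule tv.independent_insertI[OF w(2) C(1)])
  moreover have "insert w C \<subseteq> tv.span E"
    using w(1) C(2) by blast
  ultimately have "finite (insert w C) \<and> card (insert w C) \<le> card E"
    by (rule tv.independent_span_bound[OF E])
  moreover have "w \<notin> C"
    by (rule contra_subsetD[OF tv.span_superset w(2)])
  ultimately show False
    using C(3,4) by simp
qed


section \<open>Smooth functions on a manifold\<close>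

locale smooth_manifold =
  fixes A :: "('a::{t2_space,second_countable_topology}, 'e::euclidean_space) atlas"
  assumes atlas: "smooth_atlas A"
begin

lemma chart:
  assumes "(U, c) \<in> A"
  shows "open U" "open (c ` U)" "homeomorphism U (c ` U) c (inv_into U c)" "inj_on c U"
proof -
  have "\<forall>(U, c)\<in>A. open U \<and> open (c ` U) \<and> homeomorphism U (c ` U) c (inv_into U c)"
    using atlas unfolding smooth_atlas_def by (elim conjE)
  from bspec[OF this assms]
  show "open U" "open (c ` U)" and h: "homeomorphism U (c ` U) c (inv_into U c)"
    by simp_all
  show "inj_on c U"
    by (rule inj_on_inverseI) (rule homeomorphism_apply1[OF h])
qed

lemma chart_transition:
  assumes "(U, c) \<in> A" "(V, d) \<in> A"
  shows "smooth_on (c ` (U \<inter> V)) (d \<circ> inv_into U c)"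
proof -
  have "\<forall>(U, c)\<in>A. \<forall>(V, d)\<in>A. smooth_on (c ` (U \<inter> V)) (d \<circ> inv_into U c)"
    using atlas unfolding smooth_atlas_def by (elim conjE)
  from bspec[OF this assms(1)] assms(2) show ?thesis
    by blast
qed

lemma chart_image_open:
  assumes "(U, c) \<in> A" "open W" "W \<subseteq> U"
  shows "open (c ` W)"
proof -
  have "openin (top_of_set U) W"
    using assms by (simp add: open_subset)
  then have "openin (top_of_set (c ` U)) (c ` W)"
    using homeomorphism_imp_open_map[OF chart(3)[OF assms(1)]] by blast
  then show ?thesis
    using chart(2)[OF assms(1)] openin_open_trans by blast
qed

lemma ex_chart: obtains U c where "(U, c) \<in> A" "p \<in> U"
proof -
  have "(\<Union>(U, c)\<in>A. U) = UNIV"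
    using atlas unfolding smooth_atlas_def by (elim conjE)
  then have "p \<in> (\<Union>(U, c)\<in>A. U)"
    by simp
  then show ?thesis
    using that by blast
qed

lemma smooth_funs_chartD:
  assumes "f \<in> smooth_funs A" "(U, c) \<in> A"
  shows "smooth_on (c ` U) (\<lambda>y. f (inv_into U c y))"
  using assms unfolding smooth_funs_def comp_def by blast

lemma smooth_funsI:
  assumes "\<And>U c k. (U, c) \<in> A \<Longrightarrow> Ck_on k (c ` U) (\<lambda>y. f (inv_into U c y))"
  shows "f \<in> smooth_funs A"
  using assms unfolding smooth_funs_def smooth_on_def comp_def by auto

lemma smooth_funs_const [simp]: "(\<lambda>_. r) \<in> smooth_funs A"
  by (intro smooth_funsI Ck_on_const chart(2))

lemma smooth_funs_add [intro]:
  assumes "f \<in> smooth_funs A" "g \<in> smooth_funs A"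
  shows "(\<lambda>x. f x + g x) \<in> smooth_funs A"
  using assms
  by (intro smooth_funsI Ck_on_add chart(2)) (auto dest: smooth_funs_chartD simp: smooth_on_def)

lemma smooth_funs_mult [intro]:
  assumes "f \<in> smooth_funs A" "g \<in> smooth_funs A"
  shows "(\<lambda>x. f x * g x) \<in> smooth_funs A"
  using assms
  by (intro smooth_funsI Ck_on_bilinear[OF bounded_bilinear_mult] chart(2))
     (auto dest: smooth_funs_chartD simp: smooth_on_def)

lemma smooth_funs_minus [intro]:
  assumes "f \<in> smooth_funs A"
  shows "(\<lambda>x. - f x) \<in> smooth_funs A"
  using smooth_funs_mult[OF smooth_funs_const[of "-1"] assms] by simp

lemma smooth_funs_diff [intro]:
  assumes "f \<in> smooth_funs A" "g \<in> smooth_funs A"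
  shows "(\<lambda>x. f x - g x) \<in> smooth_funs A"
  using smooth_funs_add[OF assms(1) smooth_funs_minus[OF assms(2)]] by simp

lemma smooth_funs_power [intro]:
  assumes "f \<in> smooth_funs A"
  shows "(\<lambda>x. f x ^ k) \<in> smooth_funs A"
  using assms by (induction k) auto

lemma smooth_funs_divide [intro]:
  assumes "f \<in> smooth_funs A" "g \<in> smooth_funs A" "\<And>x. g x \<noteq> 0"
  shows "(\<lambda>x. f x / g x) \<in> smooth_funs A"
proof -
  have "(\<lambda>x. inverse (g x)) \<in> smooth_funs A"
  proof (rule smooth_funsI)
    fix U c k assume "(U, c) \<in> A"
    then show "Ck_on k (c ` U) (\<lambda>y. inverse (g (inv_into U c y)))"
      using assms(2,3) smooth_funs_chartD[of g U c]
      by (intro Ck_on_compose[OF chart(2) _ _ Ck_on_inverse]) (auto simp: smooth_on_def)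
  qed
  from smooth_funs_mult[OF assms(1) this] show ?thesis
    by (simp add: divide_inverse)
qed

text \<open>The support of the bump is the chart image of a closed ball, which is compact and hence closed in
  the Hausdorff space \<^typ>\<open>'a\<close>. Another chart domain is thus covered by two open sets, the overlap
  with \<open>U\<close> and the complement of the support, and the function is smooth on each.\<close>

lemma smooth_funs_bump:
  assumes c: "(U, c) \<in> A" and "cball y r \<subseteq> c ` U" "0 < r" and u: "smooth_on (c ` U) u"
  shows "(\<lambda>q. if q \<in> U then flat 0 (r\<^sup>2 - (c q - y) \<bullet> (c q - y)) * u (c q) else 0) \<in> smooth_funs A"
    (is "?F \<in> _")
proof (rule smooth_funsI)
  fix V d k assume d: "(V, d) \<in> A"
  let ?G = "\<lambda>z. flat 0 (r\<^sup>2 + - ((z + - y) \<bullet> (z + - y))) * u z"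
  let ?K = "inv_into U c ` cball y r"
  have "compact ?K"
    using chart(3)[OF c] assms(2)
    by (intro compact_continuous_image) (auto simp: homeomorphism_def intro: continuous_on_subset)
  then have VK: "open (d ` (V - ?K))"
    by (intro chart_image_open[OF d]) (auto intro!: open_Diff chart(1)[OF d] compact_imp_closed)
  have VU: "open (d ` (V \<inter> U))"
    by (intro chart_image_open[OF d]) (auto intro!: open_Int chart(1)[OF d] chart(1)[OF c])
  have G: "Ck_on k (c ` U) ?G" (is "Ck_on k ?cU _")
  proof -
    have o: "open ?cU" by (rule chart(2)[OF c])
    have "Ck_on k ?cU (\<lambda>z. r\<^sup>2 + - ((z + - y) \<bullet> (z + - y)))"
      by (intro Ck_on_add[OF o] Ck_on_linear[OF bounded_linear_minus[OF bounded_linear_ident] o]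
          Ck_on_bilinear[OF bounded_bilinear_inner o] Ck_on_id[OF o] Ck_on_const[OF o])
    then have "Ck_on k ?cU (\<lambda>z. flat 0 (r\<^sup>2 + - ((z + - y) \<bullet> (z + - y))))"
      by (intro Ck_on_compose[OF o open_UNIV _ Ck_on_flat]) auto
    then show ?thesis
      using u by (intro Ck_on_bilinear[OF bounded_bilinear_mult o]) (auto simp: smooth_on_def)
  qed
  have "Ck_on k (d ` (V \<inter> U)) (\<lambda>x. ?G (c (inv_into V d x)))"
    using chart_transition[OF d c] chart(4)[OF d]
    by (intro Ck_on_compose[OF VU chart(2)[OF c] _ G]) (auto simp: smooth_on_def comp_def)
  then have "Ck_on k (d ` (V \<inter> U)) (\<lambda>x. ?F (inv_into V d x))"
    by (rule Ck_on_cong[OF VU, rotated]) (use chart(4)[OF d] in auto)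
  moreover have "Ck_on k (d ` (V - ?K)) (\<lambda>x. ?F (inv_into V d x))"
  proof (rule Ck_on_cong[OF VK _ Ck_on_const[OF VK, of _ 0]])
    fix x assume "x \<in> d ` (V - ?K)"
    then obtain q where q: "q \<in> V" "q \<notin> ?K" "x = d q" by blast
    have "flat 0 (r\<^sup>2 - (c q - y) \<bullet> (c q - y)) = 0" if "q \<in> U"
    proof -
      have "c q \<notin> cball y r"
        using q(2) that chart(4)[OF c] by (metis image_eqI inv_into_f_f)
      then have "r < norm (c q - y)"
        by (simp add: dist_norm norm_minus_commute)
      then have "r\<^sup>2 < (c q - y) \<bullet> (c q - y)"
        using \<open>0 < r\<close> by (simp add: power2_norm_eq_inner[symmetric] power_strict_mono)
      then show ?thesis by (simp add: flat_def)
    qed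
    then show "0 = ?F (inv_into V d x)"
      using q chart(4)[OF d] by simp
  qed
  moreover have "?K \<subseteq> U"
    using assms(2) by (auto intro: inv_into_into)
  then have "d ` V = d ` (V \<inter> U) \<union> d ` (V - ?K)"
    by blast
  ultimately show "Ck_on k (d ` V) (\<lambda>x. ?F (inv_into V d x))"
    by (simp only: Ck_on_Un[OF VU VK])
qed


section \<open>Tangent vectors and vector fields\<close>

lemma
  assumes "v \<in> tangent_space A p" and [simp]: "f \<in> smooth_funs A" "g \<in> smooth_funs A"
  shows tangent_add: "v (\<lambda>x. f x + g x) = v f + v g"
    and tangent_scale: "v (\<lambda>x. r * f x) = r * v f"
    and tangent_mult: "v (\<lambda>x. f x * g x) = f p * v g + g p * v f"
  using assms unfolding tangent_space_def plus_fun_def times_fun_def by simp_all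

lemma tangent_notin: "v \<in> tangent_space A p \<Longrightarrow> f \<notin> smooth_funs A \<Longrightarrow> v f = 0"
  unfolding tangent_space_def by simp

lemma tangent_diff:
  assumes "v \<in> tangent_space A p" "f \<in> smooth_funs A" "g \<in> smooth_funs A"
  shows "v (\<lambda>x. f x - g x) = v f - v g"
  using tangent_add[OF assms(1,2) smooth_funs_minus[OF assms(3)]]
    tangent_scale[OF assms(1,3,3), of "-1"] by simp

lemma tangent_const [simp]:
  assumes "v \<in> tangent_space A p"
  shows "v (\<lambda>_. r) = 0"
  using tangent_mult[OF assms smooth_funs_const[of 1] smooth_funs_const[of 1]]
    tangent_scale[OF assms smooth_funs_const[of 1] smooth_funs_const[of 1], of r] by simp

lemma tangent_inverse:
  assumes "v \<in> tangent_space A p" "f \<in> smooth_funs A" and nz: "\<And>x. f x \<noteq> 0"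
  shows "v (\<lambda>x. 1 / f x) = - v f / (f p)\<^sup>2"
proof -
  have "(\<lambda>x. 1 / f x) \<in> smooth_funs A"
    using assms by auto
  from tangent_mult[OF assms(1,2) this]
  have "0 = f p * v (\<lambda>x. 1 / f x) + v f / f p"
    using nz assms(1) by simp
  then show ?thesis
    using nz[of p] by (simp add: divide_simps power2_eq_square) algebra
qed

lemma tangent_spaceI:
  assumes "\<And>f g. f \<in> smooth_funs A \<Longrightarrow> g \<in> smooth_funs A \<Longrightarrow> v (\<lambda>x. f x + g x) = v f + v g"
    and "\<And>r f. f \<in> smooth_funs A \<Longrightarrow> v (\<lambda>x. r * f x) = r * v f"
    and "\<And>f g. f \<in> smooth_funs A \<Longrightarrow> g \<in> smooth_funs A \<Longrightarrow> v (\<lambda>x. f x * g x) = f p * v g + g p * v f"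
    and "\<And>f. f \<notin> smooth_funs A \<Longrightarrow> v f = 0"
  shows "v \<in> tangent_space A p"
  using assms unfolding tangent_space_def plus_fun_def times_fun_def by blast

lemma tangent_plus [intro]:
  assumes "v \<in> tangent_space A p" "w \<in> tangent_space A p"
  shows "v + w \<in> tangent_space A p"
  using assms by (intro tangent_spaceI)
    (auto simp: tangent_add tangent_scale tangent_mult tangent_notin algebra_simps)

lemma tangent_tscale [intro]:
  assumes "v \<in> tangent_space A p"
  shows "r *\<^sub>T v \<in> tangent_space A p"
  using assms by (intro tangent_spaceI)
    (auto simp: tscale_def tangent_add tangent_scale tangent_mult tangent_notin algebra_simps)

lemma tangent_zero [simp]: "0 \<in> tangent_space A p"
  by (intro tangent_spaceI) auto

lemma tangent_uminus [intro]: "v \<in> tangent_space A p \<Longrightarrow> - v \<in> tangent_space A p"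
  using tangent_tscale[of v p "-1"] by simp

lemma tangent_minus [intro]:
  assumes "v \<in> tangent_space A p" "w \<in> tangent_space A p"
  shows "v - w \<in> tangent_space A p"
  using tangent_plus[OF assms(1) tangent_uminus[OF assms(2)]] by simp

lemma vfieldsI:
  assumes "\<And>p. X p \<in> tangent_space A p" "\<And>f. f \<in> smooth_funs A \<Longrightarrow> (\<lambda>p. X p f) \<in> smooth_funs A"
  shows "X \<in> vfields A"
  using assms unfolding vfields_def by blast

lemma vfields_tangent [simp]: "X \<in> vfields A \<Longrightarrow> X p \<in> tangent_space A p"
  unfolding vfields_def by blast

lemma vfields_smooth: "X \<in> vfields A \<Longrightarrow> f \<in> smooth_funs A \<Longrightarrow> (\<lambda>p. X p f) \<in> smooth_funs A"
  unfolding vfields_def by blast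

lemma deriv_along_smooth [intro]:
  "X \<in> vfields A \<Longrightarrow> f \<in> smooth_funs A \<Longrightarrow> deriv_along X f \<in> smooth_funs A"
  unfolding deriv_along_def by (rule vfields_smooth)

lemma vfields_add [intro]:
  assumes X: "X \<in> vfields A" and Y: "Y \<in> vfields A"
  shows "X + Y \<in> vfields A"
proof (rule vfieldsI)
  show "(\<lambda>p. (X + Y) p f) \<in> smooth_funs A" if f: "f \<in> smooth_funs A" for f
    using smooth_funs_add[OF vfields_smooth[OF X f] vfields_smooth[OF Y f]] by simp
qed (simp add: X Y tangent_plus)

lemma vfields_diff [intro]:
  assumes X: "X \<in> vfields A" and Y: "Y \<in> vfields A"
  shows "X - Y \<in> vfields A"
proof (rule vfieldsI)
  show "(\<lambda>p. (X - Y) p f) \<in> smooth_funs A" if f: "f \<in> smooth_funs A" for f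
    using smooth_funs_diff[OF vfields_smooth[OF X f] vfields_smooth[OF Y f]] by simp
qed (simp add: X Y tangent_minus)

lemma vfields_fscale [intro]:
  assumes f: "f \<in> smooth_funs A" and X: "X \<in> vfields A"
  shows "f *\<^sub>F X \<in> vfields A"
proof (rule vfieldsI)
  show "(\<lambda>p. (f *\<^sub>F X) p h) \<in> smooth_funs A" if h: "h \<in> smooth_funs A" for h
    using smooth_funs_mult[OF f vfields_smooth[OF X h]] by (simp add: fscale_def tscale_def)
qed (simp add: X fscale_def tangent_tscale)

lemma vfields_zero [simp]: "0 \<in> vfields A"
  by (intro vfieldsI) auto

lemma vfields_lie_bracket [intro]:
  assumes X: "X \<in> vfields A" and Y: "Y \<in> vfields A"
  shows "lie_bracket X Y \<in> vfields A"
proof (rule vfieldsI)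
  have 0: "X p 0 = 0" "Y p 0 = 0" for p
    using tangent_const[of "X p" p 0] tangent_const[of "Y p" p 0] X Y by (auto simp: zero_fun_def)
  note tX = vfields_tangent[OF X] and tY = vfields_tangent[OF Y]
  note t = tangent_add[OF tX] tangent_scale[OF tX] tangent_mult[OF tX]
    tangent_add[OF tY] tangent_scale[OF tY] tangent_mult[OF tY]
  show "lie_bracket X Y p \<in> tangent_space A p" for p
  proof (rule tangent_spaceI)
    fix f g assume fg: "f \<in> smooth_funs A" "g \<in> smooth_funs A"
    note sm = vfields_smooth[OF X fg(1)] vfields_smooth[OF X fg(2)]
      vfields_smooth[OF Y fg(1)] vfields_smooth[OF Y fg(2)]
    show "lie_bracket X Y p (\<lambda>x. f x + g x) = lie_bracket X Y p f + lie_bracket X Y p g"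
      using X Y fg unfolding lie_bracket_def deriv_along_def by (simp add: t sm)
    show "lie_bracket X Y p (\<lambda>x. f x * g x) = f p * lie_bracket X Y p g + g p * lie_bracket X Y p f"
      using X Y fg unfolding lie_bracket_def deriv_along_def
      by (simp add: t sm smooth_funs_mult algebra_simps)
  next
    fix r f assume f: "f \<in> smooth_funs A"
    then show "lie_bracket X Y p (\<lambda>x. r * f x) = r * lie_bracket X Y p f"
      using X Y vfields_smooth[OF X f] vfields_smooth[OF Y f]
      unfolding lie_bracket_def deriv_along_def by (simp add: t algebra_simps)
  next
    fix f assume "f \<notin> smooth_funs A"
    then have "deriv_along X f = 0" "deriv_along Y f = 0"
      using tangent_notin[OF tX] tangent_notin[OF tY] by (auto simp: deriv_along_def)
    then show "lie_bracket X Y p f = 0"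
      by (simp add: lie_bracket_def 0)
  qed
  show "(\<lambda>p. lie_bracket X Y p f) \<in> smooth_funs A" if "f \<in> smooth_funs A" for f
    unfolding lie_bracket_def using X Y that
    by (intro smooth_funs_diff vfields_smooth[OF X] vfields_smooth[OF Y] deriv_along_smooth)
qed


section \<open>Extending tangent vectors to vector fields\<close>

definition coord_vec :: "'a set \<Rightarrow> ('a \<Rightarrow> 'e) \<Rightarrow> 'e \<Rightarrow> 'a \<Rightarrow> 'a tvec" where
  "coord_vec U c i q = (\<lambda>f. if f \<in> smooth_funs A
     then frechet_derivative (\<lambda>y. f (inv_into U c y)) (at (c q)) i else 0)"

lemma coord_vec_tangent:
  assumes c: "(U, c) \<in> A" and q: "q \<in> U"
  shows "coord_vec U c i q \<in> tangent_space A q"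
proof -
  have d: "((\<lambda>y. f (inv_into U c y)) has_derivative
      frechet_derivative (\<lambda>y. f (inv_into U c y)) (at (c q))) (at (c q))" if "f \<in> smooth_funs A" for f
    using smooth_onD(1)[OF smooth_funs_chartD[OF that c], of "c q"] q
    by (simp add: frechet_derivative_works)
  have inv: "inv_into U c (c q) = q"
    using chart(4)[OF c] q by simp
  show ?thesis
  proof (rule tangent_spaceI)
    fix f g assume fg: "f \<in> smooth_funs A" "g \<in> smooth_funs A"
    show "coord_vec U c i q (\<lambda>x. f x + g x) = coord_vec U c i q f + coord_vec U c i q g"
      using fg frechet_derivative_at[OF has_derivative_add[OF d[OF fg(1)] d[OF fg(2)]], THEN fun_cong]
      by (simp add: coord_vec_def smooth_funs_add)
    show "coord_vec U c i q (\<lambda>x. f x * g x) = f q * coord_vec U c i q g + g q * coord_vec U c i q f"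
      using fg frechet_derivative_at[OF has_derivative_mult[OF d[OF fg(1)] d[OF fg(2)]], THEN fun_cong]
      by (simp add: coord_vec_def smooth_funs_mult inv algebra_simps)
  next
    fix r f assume f: "f \<in> smooth_funs A"
    then show "coord_vec U c i q (\<lambda>x. r * f x) = r * coord_vec U c i q f"
      using frechet_derivative_at[OF has_derivative_mult_right[OF d[OF f], of r], THEN fun_cong]
      by (simp add: coord_vec_def smooth_funs_mult)
  qed (simp add: coord_vec_def)
qed

text \<open>The coordinate functions centred at \<open>p\<close>, cut off by a bump, are globally smooth and form up to a
  common positive factor a dual family to the coordinate vectors.\<close>

lemma independent_coord_vec:
  assumes c: "(U, c) \<in> A" and p: "p \<in> U"
  shows "inj_on (\<lambda>i. coord_vec U c i p) Basis"
    and "tv.independent ((\<lambda>i. coord_vec U c i p) ` Basis)"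
proof -
  obtain r where r: "0 < r" "cball (c p) r \<subseteq> c ` U"
    using chart(2)[OF c] p open_contains_cball by blast
  define x where "x j q = (if q \<in> U then flat 0 (r\<^sup>2 - (c q - c p) \<bullet> (c q - c p)) * ((c q - c p) \<bullet> j) else 0)"
    for j q
  have x_smooth: "x j \<in> smooth_funs A" for j
  proof -
    have o: "open (c ` U)" by (rule chart(2)[OF c])
    have "smooth_on (c ` U) (\<lambda>z. (z + - c p) \<bullet> j)"
      unfolding smooth_on_def
      by (intro allI Ck_on_linear[OF bounded_linear_inner_left o] Ck_on_add[OF o] Ck_on_id[OF o] Ck_on_const[OF o])
    then show ?thesis
      using smooth_funs_bump[OF c r(2,1)] unfolding x_def by simp
  qed
  have dx: "coord_vec U c i p (x j) = flat 0 (r\<^sup>2) * (i \<bullet> j)" for i j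
  proof -
    let ?b = "\<lambda>z. flat 0 (r\<^sup>2 - (z - c p) \<bullet> (z - c p))"
    let ?s = "\<lambda>z. r\<^sup>2 - (z - c p) \<bullet> (z - c p)"
    have "(?s has_derivative (\<lambda>v. 0)) (at (c p))"
      by (auto intro!: derivative_eq_intros)
    moreover have "(flat 0 has_derivative (*) (flat 2 (r\<^sup>2))) (at (?s (c p)))"
      using has_derivative_flat[of 0 "r\<^sup>2"] by (simp add: has_field_derivative_def numeral_2_eq_2)
    ultimately have "(?b has_derivative (\<lambda>v. 0)) (at (c p))"
      by (auto dest: has_derivative_compose)
    then have "((\<lambda>z. ?b z * ((z - c p) \<bullet> j)) has_derivative (\<lambda>v. flat 0 (r\<^sup>2) * (v \<bullet> j))) (at (c p))"
      by (auto intro!: derivative_eq_intros)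
    then have "((\<lambda>y. x j (inv_into U c y)) has_derivative (\<lambda>v. flat 0 (r\<^sup>2) * (v \<bullet> j))) (at (c p))"
      by (rule has_derivative_transform_within_open[OF _ chart(2)[OF c]])
         (use p chart(4)[OF c] in \<open>auto simp: x_def\<close>)
    then show ?thesis
      using x_smooth by (simp add: coord_vec_def flip: frechet_derivative_at)
  qed
  have pos: "flat 0 (r\<^sup>2) > 0"
    using r(1) by (simp add: flat_def)
  show "inj_on (\<lambda>i. coord_vec U c i p) Basis"
  proof (rule inj_onI)
    fix i j :: 'e assume ij: "i \<in> Basis" "j \<in> Basis" "coord_vec U c i p = coord_vec U c j p"
    then have "flat 0 (r\<^sup>2) * (i \<bullet> i) = flat 0 (r\<^sup>2) * (j \<bullet> i)"
      unfolding dx[symmetric] by (simp only:)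
    then show "i = j"
      using pos ij by (auto simp: inner_Basis split: if_splits)
  qed
  show "tv.independent ((\<lambda>i. coord_vec U c i p) ` Basis)"
    unfolding tv.dependent_def
  proof
    assume "\<exists>w\<in>(\<lambda>i. coord_vec U c i p) ` Basis. w \<in> tv.span ((\<lambda>i. coord_vec U c i p) ` Basis - {w})"
    then obtain j where j: "j \<in> Basis"
      "coord_vec U c j p \<in> tv.span ((\<lambda>i. coord_vec U c i p) ` Basis - {coord_vec U c j p})"
      by blast
    have "tv.subspace {w. w (x j) = 0}"
      by (auto simp: tv.subspace_def tscale_def)
    moreover have "(\<lambda>i. coord_vec U c i p) ` Basis - {coord_vec U c j p} \<subseteq> {w. w (x j) = 0}"
      using j(1) by (auto simp: dx inner_Basis)
    ultimately have "coord_vec U c j p (x j) = 0"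
      using subsetD[OF tv.span_minimal j(2)] by blast
    then show False
      using dx pos j(1) by simp
  qed
qed

lemma coord_vec_extend:
  assumes c: "(U, c) \<in> A" and p: "p \<in> U"
  shows "\<exists>X\<in>vfields A. X p = coord_vec U c i p"
proof -
  obtain r where r: "0 < r" "cball (c p) r \<subseteq> c ` U"
    using chart(2)[OF c] p open_contains_cball by blast
  define X where "X q = (if q \<in> U then flat 0 (r\<^sup>2 - (c q - c p) \<bullet> (c q - c p)) *\<^sub>T coord_vec U c i q else 0)"
    for q
  have "X \<in> vfields A"
  proof (rule vfieldsI)
    show "X q \<in> tangent_space A q" for q
      using coord_vec_tangent[OF c] by (auto simp: X_def)
    show "(\<lambda>q. X q f) \<in> smooth_funs A" if f: "f \<in> smooth_funs A" for f
    proof -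
      have "smooth_on (c ` U) (\<lambda>y. frechet_derivative (\<lambda>y. f (inv_into U c y)) (at y) i)"
        using smooth_onD(2)[OF smooth_funs_chartD[OF f c]] p by blast
      from smooth_funs_bump[OF c r(2,1) this] show ?thesis
        using f by (simp add: X_def coord_vec_def tscale_def if_distrib[of "\<lambda>v. v _"] cong: if_cong)
    qed
  qed
  moreover have "flat 0 (r\<^sup>2) \<noteq> 0"
    using r(1) by (simp add: flat_def)
  then have "((\<lambda>_. 1 / flat 0 (r\<^sup>2)) *\<^sub>F X) p = coord_vec U c i p"
    using p by (simp add: X_def fscale_def tscale_def)
  ultimately show ?thesis
    using vfields_fscale[OF smooth_funs_const] by blast
qed

text \<open>A tangent vector is an abstract derivation, and writing it in coordinates directly would need
  Hadamard's lemma. Knowing the dimension of the tangent space is enough instead: the coordinate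
  vectors are independent and as many as the dimension, so they span it, and each of them extends.\<close>

lemma tangent_extend:
  assumes e: "finite E" "card E = DIM('e)" "tv.span E = tangent_space A p"
    and v: "v \<in> tangent_space A p"
  shows "\<exists>X\<in>vfields A. X p = v"
proof -
  obtain U c where c: "(U, c) \<in> A" "p \<in> U"
    using ex_chart by blast
  let ?C = "(\<lambda>i. coord_vec U c i p) ` Basis"
  note ind = independent_coord_vec[OF c]
  have "?C \<subseteq> tv.span E"
    using coord_vec_tangent[OF c] e(3) by auto
  then have "tv.span E \<subseteq> tv.span ?C"
    using e(1,2) ind by (intro span_subset_span_if_card_eq) (auto simp: card_image)
  then have "v \<in> tv.span ?C"
    using v e(3) by blast
  moreover have "tv.subspace ((\<lambda>X. X p) ` vfields A)"
  proof (rule tv.subspaceI)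
    show "0 \<in> (\<lambda>X. X p) ` vfields A"
      by (rule image_eqI[OF _ vfields_zero]) simp
    show "u + w \<in> (\<lambda>X. X p) ` vfields A"
      if "u \<in> (\<lambda>X. X p) ` vfields A" "w \<in> (\<lambda>X. X p) ` vfields A" for u w
    proof -
      from that obtain X Y where "u = X p" "X \<in> vfields A" "w = Y p" "Y \<in> vfields A"
        by (elim imageE)
      then show ?thesis
        by (intro image_eqI[of _ _ "X + Y"]) auto
    qed
    show "r *\<^sub>T u \<in> (\<lambda>X. X p) ` vfields A" if "u \<in> (\<lambda>X. X p) ` vfields A" for r u
    proof -
      from that obtain X where "u = X p" "X \<in> vfields A"
        by (elim imageE)
      then show ?thesis
        using vfields_fscale[OF smooth_funs_const, of X r]
        by (intro image_eqI[of _ _ "(\<lambda>_. r) *\<^sub>F X"]) (simp_all add: fscale_def)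
    qed
  qed
  moreover have "?C \<subseteq> (\<lambda>X. X p) ` vfields A"
    using coord_vec_extend[OF c] by (auto simp: image_iff eq_commute)
  ultimately have "v \<in> (\<lambda>X. X p) ` vfields A"
    using tv.span_minimal by (rule_tac subsetD)
  then show ?thesis
    by (auto simp: eq_commute)
qed

end


section \<open>Almost paracontact metric structures\<close>

locale paracontact = smooth_manifold A
  for A :: "('a::{t2_space,second_countable_topology}, 'e::euclidean_space) atlas" +
  fixes n :: nat and \<phi> :: "'a endo" and \<xi> :: "'a vfield" and \<eta> :: "'a oneform" and g :: "'a bilin"
  assumes paracontact: "almost_paracontact_metric A n \<phi> \<xi> \<eta> g"
begin

abbreviation "T \<equiv> tangent_space A"

lemma xi_vfield [simp]: "\<xi> \<in> vfields A"
  and eta_xi [simp]: "\<eta> p (\<xi> p) = 1"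
  and dim: "DIM('e) = 2 * n + 1"
  and metric: "pseudo_riemannian_metric A (n + 1) n g"
  and endo: "endo_field A \<phi>"
  and form: "oneform A \<eta>"
  using paracontact unfolding almost_paracontact_metric_def by auto

lemma phi_phi [simp]: "v \<in> T p \<Longrightarrow> \<phi> p (\<phi> p v) = v - \<eta> p v *\<^sub>T \<xi> p"
  and g_phi_phi: "v \<in> T p \<Longrightarrow> w \<in> T p \<Longrightarrow> g p (\<phi> p v) (\<phi> p w) = - g p v w + \<eta> p v * \<eta> p w"
  using paracontact unfolding almost_paracontact_metric_def by auto

lemma bilin: "bilin_field A g"
  and g_commute: "v \<in> T p \<Longrightarrow> w \<in> T p \<Longrightarrow> g p v w = g p w v"
  using metric unfolding pseudo_riemannian_metric_def by auto

lemma phi_tangent [simp]: "v \<in> T p \<Longrightarrow> \<phi> p v \<in> T p"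
  and phi_add: "v \<in> T p \<Longrightarrow> w \<in> T p \<Longrightarrow> \<phi> p (v + w) = \<phi> p v + \<phi> p w"
  and phi_scale: "v \<in> T p \<Longrightarrow> \<phi> p (r *\<^sub>T v) = r *\<^sub>T \<phi> p v"
  and appE_phi_vfield: "X \<in> vfields A \<Longrightarrow> appE \<phi> X \<in> vfields A"
  using endo unfolding endo_field_def by auto

lemma eta_add: "v \<in> T p \<Longrightarrow> w \<in> T p \<Longrightarrow> \<eta> p (v + w) = \<eta> p v + \<eta> p w"
  and eta_scale: "v \<in> T p \<Longrightarrow> \<eta> p (r *\<^sub>T v) = r * \<eta> p v"
  and eta_smooth: "X \<in> vfields A \<Longrightarrow> (\<lambda>p. \<eta> p (X p)) \<in> smooth_funs A"
  using form unfolding oneform_def app1_def by auto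

lemma g_add_left: "u \<in> T p \<Longrightarrow> v \<in> T p \<Longrightarrow> w \<in> T p \<Longrightarrow> g p (u + v) w = g p u w + g p v w"
  and g_add_right: "u \<in> T p \<Longrightarrow> v \<in> T p \<Longrightarrow> w \<in> T p \<Longrightarrow> g p w (u + v) = g p w u + g p w v"
  and g_scale_left: "u \<in> T p \<Longrightarrow> w \<in> T p \<Longrightarrow> g p (r *\<^sub>T u) w = r * g p u w"
  and g_scale_right: "u \<in> T p \<Longrightarrow> w \<in> T p \<Longrightarrow> g p w (r *\<^sub>T u) = r * g p w u"
  using bilin unfolding bilin_field_def by auto

lemma g_smooth: "X \<in> vfields A \<Longrightarrow> Y \<in> vfields A \<Longrightarrow> (\<lambda>p. g p (X p) (Y p)) \<in> smooth_funs A"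
  using bilin unfolding bilin_field_def app2_def by auto

lemma phi_diff: "v \<in> T p \<Longrightarrow> w \<in> T p \<Longrightarrow> \<phi> p (v - w) = \<phi> p v - \<phi> p w"
  using phi_add[of v p "- w"] phi_scale[of w p "-1"] by (simp add: tangent_uminus)

lemma eta_diff: "v \<in> T p \<Longrightarrow> w \<in> T p \<Longrightarrow> \<eta> p (v - w) = \<eta> p v - \<eta> p w"
  using eta_add[of v p "- w"] eta_scale[of w p "-1"] by (simp add: tangent_uminus)

lemma
  assumes "u \<in> T p" "v \<in> T p" "w \<in> T p"
  shows g_diff_left: "g p (u - v) w = g p u w - g p v w"
    and g_diff_right: "g p w (u - v) = g p w u - g p w v"
  using assms g_add_left[of u p "- v" w] g_add_right[of u p "- v" w]
    g_scale_left[of v p w "-1"] g_scale_right[of v p w "-1"]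
  by (simp_all add: tangent_uminus)

lemma phi_zero [simp]: "\<phi> p 0 = 0"
  using phi_scale[of 0 p 0] by simp

lemma eta_zero [simp]: "\<eta> p 0 = 0"
  using eta_scale[of 0 p 0] by simp

lemma g_zero [simp]: "w \<in> T p \<Longrightarrow> g p 0 w = 0" "w \<in> T p \<Longrightarrow> g p w 0 = 0"
  using g_scale_left[of 0 p w 0] g_scale_right[of 0 p w 0] by simp_all

lemmas tangent_closed = tangent_plus tangent_minus tangent_tscale
lemmas phi_linear = phi_add phi_scale phi_diff tangent_closed
lemmas eta_linear = eta_add eta_scale eta_diff tangent_closed
lemmas g_linear = g_add_left g_add_right g_scale_left g_scale_right g_diff_left g_diff_right tangent_closed

lemma xi_neq_0: "\<xi> p \<noteq> 0"
  using eta_xi[of p] by (auto simp del: eta_xi)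

text \<open>From \<open>\<phi>\<^sup>2 \<xi> = 0\<close> one gets \<open>0 = \<phi>\<^sup>3 \<xi> = \<phi> \<xi> - a \<xi>\<close> with \<open>a = \<eta> (\<phi> \<xi>)\<close>, so \<open>\<xi>\<close> is an eigenvector of \<open>\<phi>\<close>;
  its eigenvalue satisfies \<open>a\<^sup>2 = 0\<close>.\<close>

lemma phi_xi [simp]: "\<phi> p (\<xi> p) = 0"
proof -
  define a where "a = \<eta> p (\<phi> p (\<xi> p))"
  have phi2: "\<phi> p (\<phi> p (\<xi> p)) = 0"
    by (simp add: fun_eq_iff)
  have "\<phi> p (\<phi> p (\<phi> p (\<xi> p))) = \<phi> p (\<xi> p) - a *\<^sub>T \<xi> p"
    unfolding a_def by (intro phi_phi phi_tangent) simp
  then have u: "\<phi> p (\<xi> p) = a *\<^sub>T \<xi> p"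
    by (simp add: phi2)
  have "a *\<^sub>T a *\<^sub>T \<xi> p = \<phi> p (a *\<^sub>T \<xi> p)"
    by (subst phi_scale) (simp_all add: u)
  also have "\<dots> = 0"
    using phi2 by (simp add: u)
  finally have "a = 0"
    using xi_neq_0 by simp
  then show ?thesis
    by (simp add: u)
qed

text \<open>Compare \<open>\<phi> (\<phi>\<^sup>2 v)\<close> with \<open>\<phi>\<^sup>2 (\<phi> v)\<close>.\<close>

lemma eta_phi [simp]:
  assumes v: "v \<in> T p"
  shows "\<eta> p (\<phi> p v) = 0"
proof -
  have "\<phi> p (\<phi> p (\<phi> p v)) = \<phi> p (v - \<eta> p v *\<^sub>T \<xi> p)"
    using v by (subst phi_phi) simp_all
  then have "\<phi> p (\<phi> p (\<phi> p v)) = \<phi> p v"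
    using v by (simp add: phi_linear del: phi_phi)
  moreover have "\<phi> p (\<phi> p (\<phi> p v)) = \<phi> p v - \<eta> p (\<phi> p v) *\<^sub>T \<xi> p"
    using v by (intro phi_phi phi_tangent)
  ultimately have "\<eta> p (\<phi> p v) *\<^sub>T \<xi> p = 0"
    by (simp add: fun_eq_iff)
  then show ?thesis
    using xi_neq_0 by simp
qed

lemma g_xi: "v \<in> T p \<Longrightarrow> g p v (\<xi> p) = \<eta> p v"
  using g_phi_phi[of v p "\<xi> p"] by simp

lemma g_phi_skew:
  assumes "v \<in> T p" "w \<in> T p"
  shows "g p (\<phi> p v) w = - g p v (\<phi> p w)"
  using g_phi_phi[of v p "\<phi> p w"] assms g_xi[of "\<phi> p v" p] by (simp add: g_linear)

lemma orthonormal_basis: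
  "\<exists>e. inj_on e {..<n + 1 + n} \<and> tv.span (e ` {..<n + 1 + n}) = T p \<and>
    (\<forall>i<n + 1 + n. \<forall>j<n + 1 + n.
      g p (e i) (e j) = (if i = j then (if i < n + 1 then 1 else -1) else 0))"
proof -
  have "\<forall>p. \<exists>e. inj_on e {..<n + 1 + n} \<and> tv.independent (e ` {..<n + 1 + n}) \<and>
      tv.span (e ` {..<n + 1 + n}) = T p \<and>
      (\<forall>i<n + 1 + n. \<forall>j<n + 1 + n.
        g p (e i) (e j) = (if i = j then (if i < n + 1 then 1 else -1) else 0))"
    using metric unfolding pseudo_riemannian_metric_def by (elim conjE)
  from spec[OF this, of p] show ?thesis
    by (elim exE conjE, intro exI conjI)
qed

lemma g_nondegenerate:
  assumes u: "u \<in> T p" and 0: "\<And>w. w \<in> T p \<Longrightarrow> g p u w = 0"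
  shows "u = 0"
proof -
  obtain e where "inj_on e {..<n + 1 + n}" and e: "tv.span (e ` {..<n + 1 + n}) = T p" and
    ortho: "\<forall>i<n + 1 + n. \<forall>j<n + 1 + n.
      g p (e i) (e j) = (if i = j then (if i < n + 1 then 1 else -1) else 0)"
    using orthonormal_basis[of p] by (elim exE conjE)
  let ?E = "e ` {..<n + 1 + n}"
  have ET: "?E \<subseteq> T p"
    using tv.span_superset[of ?E] by (simp only: e)
  have "u \<in> tv.span ?E"
    using u by (simp only: e)
  then obtain r where r: "u = (\<Sum>v\<in>?E. r v *\<^sub>T v)"
    unfolding tv.span_finite[OF finite_imageI[OF finite_lessThan]] by (elim rangeE)
  have sum: "(\<Sum>v\<in>F. r v *\<^sub>T v) \<in> T p \<and> g p (\<Sum>v\<in>F. r v *\<^sub>T v) w = (\<Sum>v\<in>F. r v * g p v w)"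
    if "finite F" "F \<subseteq> T p" "w \<in> T p" for F w
    using that
  proof (induction F)
    case empty
    then show ?case
      by (simp flip: zero_fun_def)
  qed (simp add: g_linear)
  have "r w = 0" if w: "w \<in> ?E" for w
  proof -
    have "0 = (\<Sum>v\<in>?E. r v * g p v w)"
      using sum[of ?E w] 0[of w] w ET r by auto
    also have "\<dots> = (\<Sum>v\<in>{w}. r v * g p v w)"
      using w by (intro sum.mono_neutral_right) (auto simp: ortho split: if_splits)
    finally show ?thesis
      using w ortho by (auto split: if_splits)
  qed
  then show ?thesis
    unfolding r by (intro sum.neutral) (auto simp: tscale_def)
qed

lemma vfield_extend:
  assumes "v \<in> T p"
  obtains X where "X \<in> vfields A" "X p = v"
proof -
  obtain e where "inj_on e {..<n + 1 + n}" "tv.span (e ` {..<n + 1 + n}) = T p"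
    using orthonormal_basis[of p] by (elim exE conjE)
  then have "\<exists>X\<in>vfields A. X p = v"
    by (intro tangent_extend[of "e ` {..<n + 1 + n}"]) (auto simp: card_image dim assms)
  then show ?thesis
    using that by blast
qed

text \<open>Nondegeneracy of \<open>g\<close> on vector fields. Tangent vectors have to be extended, since the hypothesis
  only tests against global fields.\<close>

lemma vfield_eqI:
  assumes X: "X \<in> vfields A" and Y: "Y \<in> vfields A"
    and eq: "\<And>Z p. Z \<in> vfields A \<Longrightarrow> g p (X p) (Z p) = g p (Y p) (Z p)"
  shows "X = Y"
proof
  fix p
  have "X p - Y p = 0"
  proof (rule g_nondegenerate)
    fix w assume w: "w \<in> T p"
    obtain Z where "Z \<in> vfields A" "Z p = w"
      using vfield_extend[OF w] .
    then show "g p (X p - Y p) w = 0"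
      using eq[of Z p] X Y by (auto simp: g_linear)
  qed (simp add: X Y tangent_minus)
  then show "X p = Y p" by simp
qed

text \<open>Evaluating \<open>df \<and> \<eta> = 0\<close> on \<open>(v, \<xi>)\<close> gives \<open>df = df(\<xi>) \<eta>\<close>, the form in which \<open>R\<^sub>\<eta>\<close> is used below.\<close>

lemma R_class_iff:
  "f \<in> R_class A \<eta> \<longleftrightarrow> f \<in> smooth_funs A \<and> (\<forall>p. \<forall>v\<in>T p. v f = \<xi> p f * \<eta> p v)"
proof (intro iffI conjI allI ballI)
  fix p v assume f: "f \<in> R_class A \<eta>" and v: "v \<in> T p"
  then have "wedge11 (d0 f) \<eta> p v (\<xi> p) = 0"
    by (simp add: R_class_def)
  then show "v f = \<xi> p f * \<eta> p v"
    by (simp add: wedge11_def d0_def)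
next
  assume f: "f \<in> smooth_funs A \<and> (\<forall>p. \<forall>v\<in>T p. v f = \<xi> p f * \<eta> p v)"
  then have vf: "v f = \<xi> p f * \<eta> p v" if "v \<in> T p" for p v
    using that by blast
  have "v f * \<eta> p w - w f * \<eta> p v = 0" if "v \<in> T p" "w \<in> T p" for p v w
    unfolding vf[OF that(1)] vf[OF that(2)] by simp
  then show "f \<in> R_class A \<eta>"
    using f by (simp add: R_class_def wedge11_def d0_def)
qed (simp add: R_class_def)

lemma R_classI:
  assumes "f \<in> smooth_funs A" "\<And>p v. v \<in> T p \<Longrightarrow> v f = \<xi> p f * \<eta> p v"
  shows "f \<in> R_class A \<eta>"
  using assms by (simp add: R_class_iff)

lemma R_class_smooth: "f \<in> R_class A \<eta> \<Longrightarrow> f \<in> smooth_funs A"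
  by (simp add: R_class_iff)

lemma R_class_tangent: "f \<in> R_class A \<eta> \<Longrightarrow> v \<in> T p \<Longrightarrow> v f = \<xi> p f * \<eta> p v"
  by (simp add: R_class_iff)

lemma R_class_const: "(\<lambda>_. r) \<in> R_class A \<eta>"
  by (rule R_classI) (simp_all add: tangent_const[OF vfields_tangent[OF xi_vfield]])

lemma R_class_add:
  assumes f: "f \<in> R_class A \<eta>" and h: "h \<in> R_class A \<eta>"
  shows "(\<lambda>x. f x + h x) \<in> R_class A \<eta>"
proof (rule R_classI)
  note s = R_class_smooth[OF f] R_class_smooth[OF h]
  show "(\<lambda>x. f x + h x) \<in> smooth_funs A"
    by (rule smooth_funs_add[OF s])
  show "v (\<lambda>x. f x + h x) = \<xi> p (\<lambda>x. f x + h x) * \<eta> p v" if v: "v \<in> T p" for v p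
    using v tangent_add[OF v s] tangent_add[OF vfields_tangent s, OF xi_vfield]
      R_class_tangent[OF f v] R_class_tangent[OF h v] by (simp add: algebra_simps)
qed

lemma R_class_mult:
  assumes f: "f \<in> R_class A \<eta>" and h: "h \<in> R_class A \<eta>"
  shows "(\<lambda>x. f x * h x) \<in> R_class A \<eta>"
proof (rule R_classI)
  note s = R_class_smooth[OF f] R_class_smooth[OF h]
  show "(\<lambda>x. f x * h x) \<in> smooth_funs A"
    by (rule smooth_funs_mult[OF s])
  show "v (\<lambda>x. f x * h x) = \<xi> p (\<lambda>x. f x * h x) * \<eta> p v" if v: "v \<in> T p" for v p
    using v tangent_mult[OF v s] tangent_mult[OF vfields_tangent s, OF xi_vfield]
      R_class_tangent[OF f v] R_class_tangent[OF h v] by (simp add: algebra_simps)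
qed

lemma R_class_inverse:
  assumes f: "f \<in> R_class A \<eta>" and nz: "\<And>x. f x \<noteq> 0"
  shows "(\<lambda>x. 1 / f x) \<in> R_class A \<eta>"
proof (rule R_classI)
  note s = R_class_smooth[OF f]
  show "(\<lambda>x. 1 / f x) \<in> smooth_funs A"
    by (rule smooth_funs_divide[OF smooth_funs_const s nz])
  show "v (\<lambda>x. 1 / f x) = \<xi> p (\<lambda>x. 1 / f x) * \<eta> p v" if v: "v \<in> T p" for v p
    using v tangent_inverse[OF v s nz] tangent_inverse[OF vfields_tangent s nz, OF xi_vfield]
      R_class_tangent[OF f v] by simp
qed

text \<open>This is \<open>0 = d(df) = d(\<xi> f) \<and> \<eta> + (\<xi> f) d\<eta>\<close>, written out on a field \<open>X\<close> through \<open>v\<close> and \<open>\<xi>\<close>.\<close>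

lemma R_class_xi:
  assumes f: "f \<in> R_class A \<eta>"
    and closed: "\<And>X Y. X \<in> vfields A \<Longrightarrow> Y \<in> vfields A \<Longrightarrow> d1 \<eta> X Y = 0"
  shows "(\<lambda>p. \<xi> p f) \<in> R_class A \<eta>"
proof (rule R_classI)
  note s = R_class_smooth[OF f]
  show b: "(\<lambda>p. \<xi> p f) \<in> smooth_funs A"
    by (rule vfields_smooth[OF xi_vfield s])
  fix p v assume v: "v \<in> T p"
  obtain X where X: "X \<in> vfields A" "X p = v"
    using vfield_extend[OF v] .
  have "\<eta> p (lie_bracket X \<xi> p) = - \<xi> p (\<lambda>q. \<eta> q (X q))"
    using fun_cong[OF closed[OF X(1) xi_vfield], of p] tangent_const[of "X p" p 1] X(1)
    by (simp add: d1_def deriv_along_def app1_def)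
  moreover have "lie_bracket X \<xi> p f = \<xi> p f * \<eta> p (lie_bracket X \<xi> p)"
    by (rule R_class_tangent[OF f]) (simp add: X vfields_lie_bracket)
  moreover have "lie_bracket X \<xi> p f = v (\<lambda>p. \<xi> p f) - \<xi> p (\<lambda>q. \<xi> q f * \<eta> q (X q))"
    using R_class_tangent[OF f vfields_tangent[OF X(1)]] X(2)
    by (simp add: lie_bracket_def deriv_along_def)
  ultimately show "v (\<lambda>p. \<xi> p f) = \<xi> p (\<lambda>p. \<xi> p f) * \<eta> p v"
    using tangent_mult[OF vfields_tangent[OF xi_vfield] b eta_smooth[OF X(1)], of p] X(2)
    by (simp add: algebra_simps)
qed

end


section \<open>The covariant derivative of the Reeb field\<close>

locale paracosymplectic = paracontact A n \<phi> \<xi> \<eta> g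
  for A :: "('a::{t2_space,second_countable_topology}, 'e::euclidean_space) atlas"
    and n \<phi> \<xi> \<eta> g +
  fixes \<alpha> :: "'a \<Rightarrow> real" and D :: "'a connection"
  assumes paracosymplectic: "almost_paracosymplectic A n \<alpha> \<phi> \<xi> \<eta> g"
    and levi_civita: "levi_civita A g D"
begin

lemma alpha_smooth: "\<alpha> \<in> smooth_funs A"
  and eta_closed: "\<And>X Y. X \<in> vfields A \<Longrightarrow> Y \<in> vfields A \<Longrightarrow> d1 \<eta> X Y = 0"
  and d_fundamental_form: "\<And>X Y Z. X \<in> vfields A \<Longrightarrow> Y \<in> vfields A \<Longrightarrow> Z \<in> vfields A \<Longrightarrow>
    d2 (fundamental_form \<phi> g) X Y Z = 2 * \<alpha> * wedge12 \<eta> (fundamental_form \<phi> g) X Y Z"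
  using paracosymplectic unfolding almost_paracosymplectic_def by simp_all

lemma affine: "affine_connection A D"
  and torsion_free: "X \<in> vfields A \<Longrightarrow> Y \<in> vfields A \<Longrightarrow> lie_bracket X Y = D X Y - D Y X"
  and metric_compat: "X \<in> vfields A \<Longrightarrow> Y \<in> vfields A \<Longrightarrow> Z \<in> vfields A \<Longrightarrow>
    X p (\<lambda>q. g q (Y q) (Z q)) = g p (D X Y p) (Z p) + g p (Y p) (D X Z p)"
  using levi_civita unfolding levi_civita_def
  by (auto simp: deriv_along_def app2_def fun_eq_iff)

lemma D_vfield [simp]: "X \<in> vfields A \<Longrightarrow> Y \<in> vfields A \<Longrightarrow> D X Y \<in> vfields A"
  and D_add_left: "X \<in> vfields A \<Longrightarrow> Y \<in> vfields A \<Longrightarrow> Z \<in> vfields A \<Longrightarrow> D (X + Y) Z = D X Z + D Y Z"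
  and D_add_right: "X \<in> vfields A \<Longrightarrow> Y \<in> vfields A \<Longrightarrow> Z \<in> vfields A \<Longrightarrow> D X (Y + Z) = D X Y + D X Z"
  and D_fscale_left: "f \<in> smooth_funs A \<Longrightarrow> X \<in> vfields A \<Longrightarrow> Y \<in> vfields A \<Longrightarrow>
    D (f *\<^sub>F X) Y = f *\<^sub>F D X Y"
  and D_fscale_right: "f \<in> smooth_funs A \<Longrightarrow> X \<in> vfields A \<Longrightarrow> Y \<in> vfields A \<Longrightarrow>
    D X (f *\<^sub>F Y) = deriv_along X f *\<^sub>F Y + f *\<^sub>F D X Y"
  using affine unfolding affine_connection_def by simp_all

lemma eta_D_xi [simp]:
  assumes X: "X \<in> vfields A"
  shows "\<eta> p (D X \<xi> p) = 0"
proof -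
  have "(\<lambda>q. g q (\<xi> q) (\<xi> q)) = (\<lambda>_. 1)"
    by (simp add: g_xi)
  then have "0 = g p (D X \<xi> p) (\<xi> p) + g p (\<xi> p) (D X \<xi> p)"
    using metric_compat[OF X xi_vfield xi_vfield, of p] tangent_const[OF vfields_tangent[OF X]] by simp
  then show ?thesis
    using X g_commute[of "\<xi> p" p "D X \<xi> p"] by (simp add: g_xi)
qed

lemma eta_deriv:
  assumes X: "X \<in> vfields A" and Y: "Y \<in> vfields A"
  shows "X p (\<lambda>q. \<eta> q (Y q)) = \<eta> p (D X Y p) + g p (D X \<xi> p) (Y p)"
proof -
  have "(\<lambda>q. \<eta> q (Y q)) = (\<lambda>q. g q (Y q) (\<xi> q))"
    using Y by (simp add: g_xi)
  then show ?thesis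
    using metric_compat[OF X Y xi_vfield, of p] X Y g_commute[of "Y p" p "D X \<xi> p"] by (simp add: g_xi)
qed

text \<open>The antisymmetric part of \<open>\<nabla>\<eta>\<close> is \<open>d\<eta> = 0\<close>.\<close>

lemma D_xi_symmetric:
  assumes X: "X \<in> vfields A" and Y: "Y \<in> vfields A"
  shows "g p (D X \<xi> p) (Y p) = g p (D Y \<xi> p) (X p)"
  using fun_cong[OF eta_closed[OF X Y], of p] X Y
  by (simp add: d1_def deriv_along_def app1_def eta_deriv torsion_free eta_diff)

lemma D_xi_xi [simp]: "D \<xi> \<xi> = 0"
proof (rule vfield_eqI)
  fix Z p assume Z: "Z \<in> vfields A"
  then show "g p (D \<xi> \<xi> p) (Z p) = g p (0 p) (Z p)"
    using D_xi_symmetric[OF xi_vfield Z, of p] by (simp add: g_xi)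
qed simp_all

lemma phi_vfield [simp]: "X \<in> vfields A \<Longrightarrow> appE \<phi> X \<in> vfields A"
  by (rule appE_phi_vfield)

abbreviation "h \<equiv> h_op \<phi> \<xi>"

lemma h_def: "h X = (\<lambda>_. 1 / 2) *\<^sub>F (lie_bracket \<xi> (appE \<phi> X) - appE \<phi> (lie_bracket \<xi> X))"
  by (simp add: h_op_def lie_deriv_endo_def)

lemma h_vfield [simp]: "X \<in> vfields A \<Longrightarrow> h X \<in> vfields A"
  unfolding h_def by (intro vfields_fscale smooth_funs_const vfields_diff phi_vfield vfields_lie_bracket xi_vfield)

text \<open>Since \<open>\<Phi>\<close> vanishes when an argument is \<open>\<xi>\<close>, evaluating \<open>d\<Phi> = 2 \<alpha> \<eta> \<and> \<Phi>\<close> on \<open>(\<xi>, Y, Z)\<close> gives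
  \<open>(L\<^sub>\<xi> \<Phi>)(Y, Z) = 2 \<alpha> g(\<phi> Y, Z)\<close>. On the other hand \<open>L\<^sub>\<xi> \<Phi>\<close> is the sum of the contributions of \<open>L\<^sub>\<xi> g\<close> and
  \<open>L\<^sub>\<xi> \<phi> = 2 h\<close>, and \<open>L\<^sub>\<xi> g = 2 g(\<nabla> \<xi>, \<cdot>)\<close> by the symmetry of \<open>\<nabla> \<xi>\<close>.\<close>

lemma D_phi_xi:
  assumes Y: "Y \<in> vfields A"
  shows "D (appE \<phi> Y) \<xi> = \<alpha> *\<^sub>F appE \<phi> Y - h Y"
proof (rule vfield_eqI)
  show "D (appE \<phi> Y) \<xi> \<in> vfields A" "\<alpha> *\<^sub>F appE \<phi> Y - h Y \<in> vfields A"
    using Y alpha_smooth by (auto intro!: vfields_diff vfields_fscale)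
  fix Z p assume Z: "Z \<in> vfields A"
  let ?Q = "fundamental_form \<phi> g"
  note YZ = vfields_tangent[OF Y] vfields_tangent[OF Z]
  have Q: "app2 ?Q Y Z = (\<lambda>q. g q (appE \<phi> Y q) (Z q))" "app2 ?Q Z \<xi> = (\<lambda>_. 0)" "app2 ?Q \<xi> Y = (\<lambda>_. 0)"
    "\<And>X. X \<in> vfields A \<Longrightarrow> app2 ?Q X \<xi> = (\<lambda>_. 0)"
    using Y Z by (simp_all add: app2_def fundamental_form_def g_xi fun_eq_iff)
  have brackets: "lie_bracket Y Z \<in> vfields A" "lie_bracket \<xi> Y \<in> vfields A"
    using Y Z by auto
  have 0: "Y p (\<lambda>_. 0) = 0" "Z p (\<lambda>_. 0) = 0"
    using tangent_const[OF YZ(1)] tangent_const[OF YZ(2)] by auto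
  \<comment> \<open>Three of the six terms of Cartan's formula vanish because an argument of \<open>\<Phi>\<close> is \<open>\<xi>\<close>.\<close>
  have 1: "d2 ?Q \<xi> Y Z p = g p (D \<xi> (appE \<phi> Y) p) (Z p) + g p (\<phi> p (Y p)) (D \<xi> Z p)
      - g p (\<phi> p (lie_bracket \<xi> Y p)) (Z p) - g p (\<phi> p (lie_bracket Z \<xi> p)) (Y p)"
    using metric_compat[OF xi_vfield phi_vfield[OF Y] Z, of p] Q brackets
    by (simp add: d2_def deriv_along_def 0) (simp add: app2_def fundamental_form_def)
  have 2: "d2 ?Q \<xi> Y Z p = 2 * \<alpha> p * g p (\<phi> p (Y p)) (Z p)"
    unfolding d_fundamental_form[OF xi_vfield Y Z]
    by (simp add: wedge12_def Q) (simp add: app1_def)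
  have "g p (\<phi> p (lie_bracket Z \<xi> p)) (Y p) = - g p (\<phi> p (Y p)) (lie_bracket Z \<xi> p)"
    using g_phi_skew[of "lie_bracket Z \<xi> p" p "Y p"] g_commute[of "lie_bracket Z \<xi> p" p "\<phi> p (Y p)"] Y Z
    by (simp add: vfields_lie_bracket)
  also have "\<dots> = g p (\<phi> p (Y p)) (D \<xi> Z p) - g p (D (appE \<phi> Y) \<xi> p) (Z p)"
    using D_xi_symmetric[OF Z phi_vfield[OF Y], of p] g_commute[of "\<phi> p (Y p)" p "D Z \<xi> p"] Y Z
    by (simp add: torsion_free g_linear)
  finally have 3: "g p (\<phi> p (lie_bracket Z \<xi> p)) (Y p) = \<dots>" .
  have 4: "g p (D \<xi> (appE \<phi> Y) p) (Z p) = g p (lie_bracket \<xi> (appE \<phi> Y) p) (Z p) + g p (D (appE \<phi> Y) \<xi> p) (Z p)"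
    using Y Z by (simp add: torsion_free g_linear)
  have 5: "2 * g p (h Y p) (Z p) = g p (lie_bracket \<xi> (appE \<phi> Y) p) (Z p) - g p (\<phi> p (lie_bracket \<xi> Y p)) (Z p)"
    using Y Z by (simp add: h_def g_linear vfields_lie_bracket)
  have "g p (D (appE \<phi> Y) \<xi> p) (Z p) = \<alpha> p * g p (\<phi> p (Y p)) (Z p) - g p (h Y p) (Z p)"
    using 1 2 3 4 5 by simp
  then show "g p (D (appE \<phi> Y) \<xi> p) (Z p) = g p ((\<alpha> *\<^sub>F appE \<phi> Y - h Y) p) (Z p)"
    using Y Z by (simp add: g_linear)
qed

lemma lie_bracket_fscale_left:
  assumes f: "f \<in> smooth_funs A" and X: "X \<in> vfields A" and Y: "Y \<in> vfields A"
  shows "lie_bracket (f *\<^sub>F X) Y = f *\<^sub>F lie_bracket X Y - deriv_along Y f *\<^sub>F X"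
proof (intro ext)
  fix p u
  show "lie_bracket (f *\<^sub>F X) Y p u = (f *\<^sub>F lie_bracket X Y - deriv_along Y f *\<^sub>F X) p u"
  proof (cases "u \<in> smooth_funs A")
    case True
    then show ?thesis
      using tangent_mult[OF vfields_tangent[OF Y] f vfields_smooth[OF X True], of p]
      by (simp add: lie_bracket_def deriv_along_def algebra_simps)
  next
    case False
    have "lie_bracket (f *\<^sub>F X) Y \<in> vfields A" "f *\<^sub>F lie_bracket X Y - deriv_along Y f *\<^sub>F X \<in> vfields A"
      using f X Y by (auto intro!: vfields_diff vfields_fscale vfields_lie_bracket)
    then show ?thesis
      using tangent_notin[OF vfields_tangent False] by metis
  qed
qed

text \<open>Apply \<open>L\<^sub>\<xi>\<close> to \<open>\<phi>\<^sup>2 = Id - \<eta> \<otimes> \<xi>\<close>; the right-hand side is invariant under the flow of \<open>\<xi>\<close> because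
  \<open>L\<^sub>\<xi> \<eta> = d(\<eta> \<xi>) + d\<eta>(\<xi>, \<cdot>) = 0\<close>.\<close>

lemma h_phi:
  assumes X: "X \<in> vfields A"
  shows "h (appE \<phi> X) = - appE \<phi> (h X)"
proof (intro ext)
  fix p u
  let ?f = "\<lambda>q. \<eta> q (X q)"
  note f = eta_smooth[OF X]
  have pp: "appE \<phi> (appE \<phi> X) = X - ?f *\<^sub>F \<xi>"
    using X by (simp add: fun_eq_iff)
  have "lie_bracket \<xi> (X - ?f *\<^sub>F \<xi>) = lie_bracket \<xi> X - deriv_along \<xi> ?f *\<^sub>F \<xi>"
  proof -
    have "D (X - ?f *\<^sub>F \<xi>) \<xi> = D X \<xi>"
      using D_add_left[of "X - ?f *\<^sub>F \<xi>" "?f *\<^sub>F \<xi>" \<xi>] f X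
      by (simp add: D_fscale_left vfields_diff vfields_fscale) (simp add: fun_eq_iff)
    moreover have "D \<xi> (X - ?f *\<^sub>F \<xi>) = D \<xi> X - deriv_along \<xi> ?f *\<^sub>F \<xi>"
      using D_add_right[of \<xi> "X - ?f *\<^sub>F \<xi>" "?f *\<^sub>F \<xi>"] f X
      by (simp add: D_fscale_right vfields_diff vfields_fscale) (simp add: fun_eq_iff)
    ultimately show ?thesis
      using X f by (simp add: torsion_free vfields_diff vfields_fscale)
  qed
  moreover have "\<eta> p (lie_bracket \<xi> X p) = deriv_along \<xi> ?f p"
    using fun_cong[OF eta_closed[OF xi_vfield X], of p] tangent_const[OF vfields_tangent[OF X]]
    by (simp add: d1_def deriv_along_def app1_def)
  ultimately show "h (appE \<phi> X) p u = (- appE \<phi> (h X)) p u"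
    using X unfolding h_def pp
    by (simp add: phi_linear vfields_lie_bracket) (simp add: field_simps)
qed

text \<open>The field \<open>X\<close> differs from \<open>\<phi>\<^sup>2 X\<close> by a multiple of \<open>\<xi>\<close>, along which \<open>\<xi>\<close> is geodesic, so the formula
  for \<open>\<nabla>\<^bsub>\<phi> Y\<^esub> \<xi>\<close> with \<open>Y = \<phi> X\<close> determines \<open>\<nabla>\<^sub>X \<xi>\<close>.\<close>

lemma D_xi:
  assumes X: "X \<in> vfields A"
  shows "D X \<xi> = \<alpha> *\<^sub>F appE \<phi> (appE \<phi> X) + appE \<phi> (h X)"
proof -
  let ?f = "\<lambda>q. \<eta> q (X q)"
  note f = eta_smooth[OF X]
  have pp: "appE \<phi> (appE \<phi> X) = X - ?f *\<^sub>F \<xi>"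
    using X by (simp add: fun_eq_iff)
  have "D X \<xi> = D (appE \<phi> (appE \<phi> X)) \<xi>"
    using D_add_left[of "X - ?f *\<^sub>F \<xi>" "?f *\<^sub>F \<xi>" \<xi>] f X
    unfolding pp by (simp add: D_fscale_left vfields_diff vfields_fscale) (simp add: fun_eq_iff)
  also have "\<dots> = \<alpha> *\<^sub>F appE \<phi> (appE \<phi> X) + appE \<phi> (h X)"
    using D_phi_xi[OF phi_vfield[OF X]] h_phi[OF X] by simp
  finally show ?thesis .
qed

end


section \<open>The deformed structure\<close>

text \<open>Each vector of the family is orthogonal to the span of the others, but not to itself. Linearity is
  asked on one tangent space only, because a tensor field is arbitrary on other functionals.\<close>

lemma (in smooth_manifold) orthogonal_independent:
  assumes e: "\<And>i. i < N \<Longrightarrow> e i \<in> tangent_space A p"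
    and add: "\<And>u v w. u \<in> tangent_space A p \<Longrightarrow> v \<in> tangent_space A p \<Longrightarrow> w \<in> tangent_space A p \<Longrightarrow>
      b (u + v) w = b u w + b v w"
    and scale: "\<And>r u w. u \<in> tangent_space A p \<Longrightarrow> w \<in> tangent_space A p \<Longrightarrow> b (r *\<^sub>T u) w = r * b u w"
    and ortho: "\<And>i j. i < N \<Longrightarrow> j < N \<Longrightarrow> i \<noteq> j \<Longrightarrow> b (e i) (e j) = (0::real)"
    and nonnull: "\<And>i. i < N \<Longrightarrow> b (e i) (e i) \<noteq> 0"
  shows "inj_on e {..<N}" "tv.independent (e ` {..<N})"
proof -
  show "inj_on e {..<N}"
    using ortho nonnull by (intro inj_onI) (metis lessThan_iff)
  show "tv.independent (e ` {..<N})"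
    unfolding tv.dependent_def
  proof
    assume "\<exists>w\<in>e ` {..<N}. w \<in> tv.span (e ` {..<N} - {w})"
    then obtain j where j: "j < N" "e j \<in> tv.span (e ` {..<N} - {e j})"
      by auto
    let ?V = "{w \<in> tangent_space A p. b w (e j) = 0}"
    have "tv.subspace ?V"
      using e[OF j(1)] scale[of 0 "e j" 0]
      by (intro tv.subspaceI) (auto simp: add scale tangent_plus tangent_tscale)
    moreover have "e ` {..<N} - {e j} \<subseteq> ?V"
      using e ortho j(1) by auto
    ultimately have "e j \<in> ?V"
      using subsetD[OF tv.span_minimal j(2)] by blast
    then show False
      using nonnull[OF j(1)] by simp
  qed
qed

locale deformation = paracosymplectic A n \<phi> \<xi> \<eta> g \<alpha> D
  for A :: "('a::{t2_space,second_countable_topology}, 'e::euclidean_space) atlas"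
    and n \<phi> \<xi> \<eta> g \<alpha> D +
  fixes \<gamma> :: real and \<beta> :: "'a \<Rightarrow> real"
  assumes gamma_pos: "\<gamma> > 0" and beta_R_class: "\<beta> \<in> R_class A \<eta>" and beta_neq_0 [simp]: "\<beta> p \<noteq> 0"
begin

abbreviation "\<xi>' \<equiv> deform_xi \<beta> \<xi>"
abbreviation "\<eta>' \<equiv> deform_eta \<beta> \<eta>"
abbreviation "g' \<equiv> deform_g \<gamma> \<beta> \<eta> g"

lemmas beta_smooth = R_class_smooth[OF beta_R_class]
lemmas beta_tangent = R_class_tangent[OF beta_R_class]
lemmas inverse_beta_smooth = smooth_funs_divide[OF smooth_funs_const beta_smooth beta_neq_0]
lemmas xi_beta_smooth = vfields_smooth[OF xi_vfield beta_smooth]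

lemma xi'_vfield [simp]: "\<xi>' \<in> vfields A"
  unfolding deform_xi_def by (intro vfields_fscale inverse_beta_smooth xi_vfield)

lemma oneform_eta': "oneform A \<eta>'"
  unfolding oneform_def deform_eta_def app1_def
  by (simp add: eta_add eta_scale algebra_simps smooth_funs_mult[OF beta_smooth eta_smooth])

lemma bilin_g': "bilin_field A g'"
proof -
  have "(\<lambda>p. \<gamma> * g p (X p) (Y p) + ((\<beta> p)\<^sup>2 - \<gamma>) * \<eta> p (X p) * \<eta> p (Y p)) \<in> smooth_funs A"
    if "X \<in> vfields A" "Y \<in> vfields A" for X Y
    using that by (intro smooth_funs_add smooth_funs_mult smooth_funs_diff smooth_funs_power
        smooth_funs_const g_smooth eta_smooth beta_smooth)
  then show ?thesis
    unfolding bilin_field_def deform_g_def app2_def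
    by (simp add: eta_add eta_scale g_linear algebra_simps)
qed

text \<open>The signature is preserved because the linear map \<open>v \<mapsto> (v - (\<eta> v) \<xi>) / \<surd>\<gamma> + (\<eta> v / \<beta>) \<xi>\<close> is an isometry
  from \<open>g\<close> to \<open>g'\<close>: it rescales \<open>ker \<eta>\<close> and \<open>\<xi>\<close>, which are orthogonal, separately. It sends an orthonormal
  basis of \<open>g\<close>, adapted to this splitting or not, to one of \<open>g'\<close> with the same signs.\<close>

lemma metric_g': "pseudo_riemannian_metric A (n + 1) n g'"
  unfolding pseudo_riemannian_metric_def
proof (intro conjI allI ballI)
  show "bilin_field A g'"
    by (rule bilin_g')
  show "g' p v w = g' p w v" if "v \<in> T p" "w \<in> T p" for p v w
    using g_commute[OF that] by (simp add: deform_g_def)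
  fix p
  let ?N = "n + 1 + n"
  obtain e where inj: "inj_on e {..<?N}" and span: "tv.span (e ` {..<?N}) = T p" and
    ortho: "\<forall>i<?N. \<forall>j<?N. g p (e i) (e j) = (if i = j then (if i < n + 1 then 1 else -1) else 0)"
    using orthonormal_basis[of p] by (elim exE conjE)
  have eT: "e i \<in> T p" if "i < ?N" for i
    using tv.span_superset[of "e ` {..<?N}"] that unfolding span by blast
  define s where "s = 1 / sqrt \<gamma>"
  have s: "\<gamma> * (s * s) = 1"
    using gamma_pos by (simp add: s_def)
  define e' where "e' i = s *\<^sub>T (e i - \<eta> p (e i) *\<^sub>T \<xi> p) + (\<eta> p (e i) / \<beta> p) *\<^sub>T \<xi> p" for i
  have e'T: "e' i \<in> T p" if "i < ?N" for i
    using eT[OF that] by (simp add: e'_def tangent_closed)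
  have eta_e': "\<eta> p (e' i) = \<eta> p (e i) / \<beta> p" if "i < ?N" for i
    using eT[OF that] by (simp add: e'_def eta_linear)
  have g_e': "g p (e' i) (e' j) = (s * s) * (g p (e i) (e j) - \<eta> p (e i) * \<eta> p (e j))
      + \<eta> p (e i) * \<eta> p (e j) / (\<beta> p)\<^sup>2" if "i < ?N" "j < ?N" for i j
    using eT[OF that(1)] eT[OF that(2)] g_commute[of "\<xi> p" p "e j"]
    by (simp add: e'_def g_linear g_xi eta_linear) (simp add: algebra_simps power2_eq_square)
  have ortho': "g' p (e' i) (e' j) = g p (e i) (e j)" if "i < ?N" "j < ?N" for i j
  proof -
    have "g' p (e' i) (e' j) = (\<gamma> * (s * s)) * (g p (e i) (e j) - \<eta> p (e i) * \<eta> p (e j))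
        + \<gamma> * (\<eta> p (e i) * \<eta> p (e j) / (\<beta> p)\<^sup>2)
        + ((\<beta> p)\<^sup>2 - \<gamma>) * (\<eta> p (e i) * \<eta> p (e j) / (\<beta> p)\<^sup>2)"
      unfolding deform_g_def g_e'[OF that] eta_e'[OF that(1)] eta_e'[OF that(2)]
      by (simp add: algebra_simps power2_eq_square diff_divide_distrib)
    then show ?thesis
      unfolding s by (simp add: field_simps)
  qed
  have ind: "inj_on e' {..<?N}" "tv.independent (e' ` {..<?N})"
    by (rule orthogonal_independent[of ?N e' p "g' p"];
        use e'T ortho ortho' in \<open>simp add: deform_g_def eta_add eta_scale g_linear algebra_simps\<close>)+
  have "e' ` {..<?N} \<subseteq> tv.span (e ` {..<?N})"
    using e'T unfolding span by blast
  then have "T p \<subseteq> tv.span (e' ` {..<?N})"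
    using span_subset_span_if_card_eq[of "e ` {..<?N}" "e' ` {..<?N}"] ind inj
    unfolding span by (simp add: card_image)
  moreover have "tv.span (e' ` {..<?N}) \<subseteq> T p"
  proof (rule tv.span_minimal)
    show "e' ` {..<?N} \<subseteq> T p"
      using e'T by blast
    show "tv.subspace (T p)"
      by (intro tv.subspaceI) (auto intro: tangent_closed)
  qed
  ultimately have "tv.span (e' ` {..<?N}) = T p"
    by blast
  with ind show "\<exists>e. inj_on e {..<?N} \<and> tv.independent (e ` {..<?N}) \<and> tv.span (e ` {..<?N}) = T p \<and>
      (\<forall>i<?N. \<forall>j<?N. g' p (e i) (e j) = (if i = j then (if i < n + 1 then 1 else -1) else 0))"
    using ortho ortho' by (intro exI[of _ e'] conjI) simp_all
qed

lemma paracontact': "almost_paracontact_metric A n \<phi> \<xi>' \<eta>' g'"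
  unfolding almost_paracontact_metric_def
proof (intro conjI allI ballI)
  show "tv.dim {v \<in> T p. \<eta>' p v = 0 \<and> \<phi> p v = v} = n"
    "tv.dim {v \<in> T p. \<eta>' p v = 0 \<and> \<phi> p v = - v} = n" for p
    using paracontact unfolding almost_paracontact_metric_def by (simp_all add: deform_eta_def)
  show "\<eta>' p (\<xi>' p) = 1" for p
    by (simp add: deform_eta_def deform_xi_def eta_scale)
  show "\<phi> p (\<phi> p v) = v - \<eta>' p v *\<^sub>T \<xi>' p" if "v \<in> T p" for p v
    using that by (simp add: deform_eta_def deform_xi_def fun_eq_iff)
  show "g' p (\<phi> p v) (\<phi> p w) = - g' p v w + \<eta>' p v * \<eta>' p w" if "v \<in> T p" "w \<in> T p" for p v w
    using that by (simp add: deform_g_def deform_eta_def g_phi_phi algebra_simps power2_eq_square)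
qed (use dim endo xi'_vfield oneform_eta' metric_g' in simp_all)

text \<open>Here \<open>d(\<beta> \<eta>) = d\<beta> \<and> \<eta> + \<beta> d\<eta> = 0\<close>, and the fundamental form is only multiplied by \<open>\<gamma>\<close> because
  \<open>\<eta> \<circ> \<phi> = 0\<close>; the factor \<open>1 / \<beta>\<close> of \<open>\<alpha>\<close> compensates the factor \<open>\<beta>\<close> of \<open>\<eta>\<close>.\<close>

lemma paracosymplectic': "almost_paracosymplectic A n (\<lambda>p. \<alpha> p / \<beta> p) \<phi> \<xi>' \<eta>' g'"
  unfolding almost_paracosymplectic_def
proof (intro conjI ballI)
  show "(\<lambda>p. \<alpha> p / \<beta> p) \<in> smooth_funs A"
    by (intro smooth_funs_divide alpha_smooth beta_smooth beta_neq_0)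
next
  fix X Y assume X: "X \<in> vfields A" and Y: "Y \<in> vfields A"
  show "d1 \<eta>' X Y = 0"
  proof
    fix p
    have "X p (\<lambda>q. \<eta> q (Y q)) - Y p (\<lambda>q. \<eta> q (X q)) - \<eta> p (lie_bracket X Y p) = 0"
      using fun_cong[OF eta_closed[OF X Y], of p] by (simp add: d1_def deriv_along_def app1_def)
    then show "d1 \<eta>' X Y p = 0 p"
      using tangent_mult[OF vfields_tangent[OF X] beta_smooth eta_smooth[OF Y], of p]
        tangent_mult[OF vfields_tangent[OF Y] beta_smooth eta_smooth[OF X], of p]
        beta_tangent[OF vfields_tangent[OF X], of p] beta_tangent[OF vfields_tangent[OF Y], of p]
      by (simp add: d1_def deriv_along_def app1_def deform_eta_def flip: right_diff_distrib')
  qed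
next
  fix X Y Z assume X: "X \<in> vfields A" and Y: "Y \<in> vfields A" and Z: "Z \<in> vfields A"
  let ?Q = "fundamental_form \<phi> g" and ?Q' = "fundamental_form \<phi> g'"
  have Q': "app2 ?Q' U V = (\<lambda>p. \<gamma> * app2 ?Q U V p)" if "U \<in> vfields A" "V \<in> vfields A" for U V
    using that by (simp add: app2_def fundamental_form_def deform_g_def)
  have Q_smooth: "app2 ?Q U V \<in> smooth_funs A" if "U \<in> vfields A" "V \<in> vfields A" for U V
    using g_smooth[OF phi_vfield[OF that(1)] that(2)] by (simp add: app2_def fundamental_form_def)
  have scale: "W p (\<lambda>q. \<gamma> * app2 ?Q U V q) = \<gamma> * W p (app2 ?Q U V)"
    if "U \<in> vfields A" "V \<in> vfields A" "W \<in> vfields A" for U V W p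
    using tangent_scale[OF vfields_tangent[OF that(3)] Q_smooth[OF that(1,2)] smooth_funs_const] .
  have "d2 ?Q' X Y Z = (\<lambda>p. \<gamma> * d2 ?Q X Y Z p)"
    using X Y Z by (simp add: fun_eq_iff d2_def deriv_along_def Q' scale vfields_lie_bracket algebra_simps)
  then show "d2 ?Q' X Y Z = 2 * (\<lambda>p. \<alpha> p / \<beta> p) * wedge12 \<eta>' ?Q' X Y Z"
    using d_fundamental_form[OF X Y Z] X Y Z
    by (simp add: fun_eq_iff wedge12_def Q' app1_def deform_eta_def field_simps)
qed (rule paracontact')


section \<open>Levi-Civita connection and curvature of the deformed metric\<close>

text \<open>The coefficient of \<open>\<xi>\<close> in the difference of the two Levi-Civita connections. It comes out of the Koszul
  formula: \<open>\<nabla> g' = d(\<beta>\<^sup>2) \<otimes> \<eta> \<otimes> \<eta> + (\<beta>\<^sup>2 - \<gamma>) \<nabla>(\<eta> \<otimes> \<eta>)\<close>, where \<open>d(\<beta>\<^sup>2) = 2 \<beta> (\<xi> \<beta>) \<eta>\<close> and \<open>\<nabla> \<eta>\<close> is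
  symmetric, so that \<open>g'(D' X Y - D X Y, Z)\<close> is a multiple of \<open>\<eta> Z\<close>, and \<open>\<eta> = g'(\<xi>, \<cdot>) / \<beta>\<^sup>2\<close>.\<close>

definition conn_diff :: "'a vfield \<Rightarrow> 'a vfield \<Rightarrow> 'a \<Rightarrow> real" where
  "conn_diff X Y p = \<xi> p \<beta> / \<beta> p * \<eta> p (X p) * \<eta> p (Y p) + (1 - \<gamma> / (\<beta> p)\<^sup>2) * g p (D X \<xi> p) (Y p)"

definition D' :: "'a connection" where
  "D' X Y = D X Y + conn_diff X Y *\<^sub>F \<xi>"

lemma conn_diff_smooth [simp]:
  assumes X: "X \<in> vfields A" and Y: "Y \<in> vfields A"
  shows "conn_diff X Y \<in> smooth_funs A"
proof -
  have "(\<lambda>p. conn_diff X Y p) \<in> smooth_funs A"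
    unfolding conn_diff_def using X Y
    by (intro smooth_funs_add smooth_funs_mult smooth_funs_diff smooth_funs_power smooth_funs_divide
        smooth_funs_const g_smooth eta_smooth beta_smooth xi_beta_smooth D_vfield xi_vfield) simp_all
  then show ?thesis by simp
qed

lemma conn_diff_symmetric: "X \<in> vfields A \<Longrightarrow> Y \<in> vfields A \<Longrightarrow> conn_diff X Y = conn_diff Y X"
  using D_xi_symmetric[of X Y] by (simp add: conn_diff_def fun_eq_iff)

lemma affine_D': "affine_connection A D'"
  unfolding affine_connection_def
proof (intro conjI ballI)
  fix X Y assume X: "X \<in> vfields A" and Y: "Y \<in> vfields A"
  then show "D' X Y \<in> vfields A"
    unfolding D'_def by (intro vfields_add vfields_fscale) simp_all
  fix Z assume Z: "Z \<in> vfields A"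
  have "conn_diff (X + Y) Z = conn_diff X Z + conn_diff Y Z" "conn_diff X (Y + Z) = conn_diff X Y + conn_diff X Z"
    using X Y Z by (simp_all add: fun_eq_iff conn_diff_def D_add_left g_linear eta_linear algebra_simps add_divide_distrib)
  then show "D' (X + Y) Z = D' X Z + D' Y Z" "D' X (Y + Z) = D' X Y + D' X Z"
    using X Y Z by (simp_all add: D'_def D_add_left D_add_right fun_eq_iff algebra_simps)
next
  fix f X Y assume f: "f \<in> smooth_funs A" and X: "X \<in> vfields A" and Y: "Y \<in> vfields A"
  have "conn_diff (f *\<^sub>F X) Y = f * conn_diff X Y" "conn_diff X (f *\<^sub>F Y) = f * conn_diff X Y"
    using f X Y by (simp_all add: fun_eq_iff conn_diff_def D_fscale_left g_linear eta_linear algebra_simps)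
  then show "D' (f *\<^sub>F X) Y = f *\<^sub>F D' X Y" "D' X (f *\<^sub>F Y) = deriv_along X f *\<^sub>F Y + f *\<^sub>F D' X Y"
    using f X Y by (simp_all add: D'_def D_fscale_left D_fscale_right fun_eq_iff algebra_simps)
qed

lemma levi_civita_D': "levi_civita A g' D'"
  unfolding levi_civita_def
proof (intro conjI ballI)
  fix X Y assume X: "X \<in> vfields A" and Y: "Y \<in> vfields A"
  show "D' X Y - D' Y X = lie_bracket X Y"
    using X Y by (simp add: D'_def torsion_free conn_diff_symmetric[OF X Y])
  fix Z assume Z: "Z \<in> vfields A"
  show "deriv_along X (app2 g' Y Z) = app2 g' (D' X Y) Z + app2 g' Y (D' X Z)"
  proof
    fix p
    note tX = vfields_tangent[OF X, of p]
    let ?\<psi> = "\<lambda>q. (\<beta> q)\<^sup>2 - \<gamma>" and ?Y = "\<lambda>q. \<eta> q (Y q)" and ?Z = "\<lambda>q. \<eta> q (Z q)"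
    have psi: "?\<psi> \<in> smooth_funs A" "(\<lambda>q. ?\<psi> q * ?Y q) \<in> smooth_funs A" "(\<lambda>q. ?\<psi> q * ?Y q * ?Z q) \<in> smooth_funs A"
      by (intro smooth_funs_diff smooth_funs_power smooth_funs_const smooth_funs_mult beta_smooth
          eta_smooth Y Z)+
    have "X p ?\<psi> = 2 * \<beta> p * (\<xi> p \<beta> * \<eta> p (X p))"
      using tangent_diff[OF tX smooth_funs_power[OF beta_smooth, of 2] smooth_funs_const[of \<gamma>]]
        tangent_mult[OF tX beta_smooth beta_smooth] tangent_const[OF tX] beta_tangent[OF tX]
      by (simp add: power2_eq_square)
    moreover have "X p (app2 g' Y Z) = \<gamma> * X p (\<lambda>q. g q (Y q) (Z q))
        + ((?\<psi> p * ?Y p) * X p ?Z + ?Z p * (?\<psi> p * X p ?Y + ?Y p * X p ?\<psi>))"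
      using tangent_add[OF tX smooth_funs_mult[OF smooth_funs_const g_smooth[OF Y Z]] psi(3), of \<gamma>]
        tangent_scale[OF tX g_smooth[OF Y Z] smooth_funs_const, of \<gamma>]
        tangent_mult[OF tX psi(2) eta_smooth[OF Z]] tangent_mult[OF tX psi(1) eta_smooth[OF Y]]
      by (simp add: app2_def deform_g_def)
    ultimately have lhs: "X p (app2 g' Y Z) = \<gamma> * (g p (D X Y p) (Z p) + g p (Y p) (D X Z p))
        + ?\<psi> p * (?Y p * (\<eta> p (D X Z p) + g p (D X \<xi> p) (Z p)) + ?Z p * (\<eta> p (D X Y p) + g p (D X \<xi> p) (Y p)))
        + 2 * \<beta> p * \<xi> p \<beta> * \<eta> p (X p) * ?Y p * ?Z p"
      by (simp add: eta_deriv[OF X Y] eta_deriv[OF X Z] metric_compat[OF X Y Z] algebra_simps)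
    have D': "g' p (D' X U p) (V p) = g' p (D X U p) (V p) + (\<beta> p)\<^sup>2 * conn_diff X U p * \<eta> p (V p)"
      if U: "U \<in> vfields A" and V: "V \<in> vfields A" for U V
      using X U V g_commute[of "\<xi> p" p "V p"]
      by (simp add: D'_def deform_g_def g_linear eta_linear g_xi algebra_simps)
    have "(\<beta> p)\<^sup>2 * conn_diff X U p = \<beta> p * \<xi> p \<beta> * \<eta> p (X p) * \<eta> p (U p) + ?\<psi> p * g p (D X \<xi> p) (U p)" for U
      by (simp add: conn_diff_def field_simps power2_eq_square)
    then have rhs: "g' p (D' X U p) (V p) = g' p (D X U p) (V p)
        + (\<beta> p * \<xi> p \<beta> * \<eta> p (X p) * \<eta> p (U p) + ?\<psi> p * g p (D X \<xi> p) (U p)) * \<eta> p (V p)"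
      if "U \<in> vfields A" "V \<in> vfields A" for U V
      using D'[OF that] by simp
    have "g' p (Y p) (D' X Z p) = g' p (D' X Z p) (Y p)"
      using g_commute[of "Y p" p "D' X Z p"] affine_D' X Y Z
      by (simp add: deform_g_def affine_connection_def)
    then have "(app2 g' (D' X Y) Z + app2 g' Y (D' X Z)) p = g' p (D' X Y p) (Z p) + g' p (D' X Z p) (Y p)"
      by (simp add: app2_def)
    also have "\<dots> = X p (app2 g' Y Z)"
      unfolding lhs rhs[OF Y Z] rhs[OF Z Y]
      using g_commute[of "Y p" p "D X Z p"] X Y Z by (simp add: deform_g_def algebra_simps)
    finally show "deriv_along X (app2 g' Y Z) p = (app2 g' (D' X Y) Z + app2 g' Y (D' X Z)) p"
      by (simp add: deriv_along_def)
  qed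
qed (rule affine_D')

text \<open>The term \<open>(\<xi> \<beta> / \<beta>\<^sup>2) (\<eta> X) \<xi>\<close> from the change of connection cancels the derivative of the factor
  \<open>1 / \<beta>\<close> in \<open>\<xi>'\<close>.\<close>

lemma D'_xi':
  assumes X: "X \<in> vfields A"
  shows "D' X \<xi>' = (\<lambda>p. 1 / \<beta> p) *\<^sub>F D X \<xi>"
proof (intro ext)
  fix p u
  show "D' X \<xi>' p u = ((\<lambda>p. 1 / \<beta> p) *\<^sub>F D X \<xi>) p u"
    using tangent_inverse[OF vfields_tangent[OF X] beta_smooth beta_neq_0, of p]
      beta_tangent[OF vfields_tangent[OF X], of p] X
    by (simp add: D'_def conn_diff_def deform_xi_def D_fscale_right inverse_beta_smooth deriv_along_def
        g_linear eta_linear g_xi) (simp add: field_simps power2_eq_square)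
qed

text \<open>The connections differ on \<open>\<nabla>\<^sub>Y \<xi>\<close> by \<open>conn_diff X (D Y \<xi>)\<close>, which is symmetric in \<open>X\<close> and \<open>Y\<close> because
  \<open>\<eta> (\<nabla>\<^sub>Y \<xi>) = 0\<close>, and so drops out. What remains is the rescaling and the derivative of \<open>1 / \<beta>\<close>.\<close>

lemma curvature_D'_xi':
  assumes X: "X \<in> vfields A" and Y: "Y \<in> vfields A"
  shows "curvature D' X Y \<xi>' = (\<lambda>p. 1 / \<beta> p) *\<^sub>F curvature D X Y \<xi>
    + (\<lambda>p. \<xi> p \<beta> / (\<beta> p)\<^sup>2) *\<^sub>F (app1 \<eta> Y *\<^sub>F D X \<xi> - app1 \<eta> X *\<^sub>F D Y \<xi>)"
proof (intro ext)
  fix p u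
  have leibniz: "D' U ((\<lambda>p. 1 / \<beta> p) *\<^sub>F D V \<xi>) p = (- (\<xi> p \<beta> * \<eta> p (U p)) / (\<beta> p)\<^sup>2) *\<^sub>T D V \<xi> p
      + (1 / \<beta> p) *\<^sub>T D U (D V \<xi>) p
      + ((1 - \<gamma> / (\<beta> p)\<^sup>2) * g p (D U \<xi> p) (D V \<xi> p) / \<beta> p) *\<^sub>T \<xi> p"
    if U: "U \<in> vfields A" and V: "V \<in> vfields A" for U V
    using tangent_inverse[OF vfields_tangent[OF U] beta_smooth beta_neq_0, of p]
      beta_tangent[OF vfields_tangent[OF U], of p] U V
    by (simp add: fun_eq_iff D'_def conn_diff_def D_fscale_right inverse_beta_smooth deriv_along_def
        g_linear eta_linear)
  have "g p (D X \<xi> p) (D Y \<xi> p) = g p (D Y \<xi> p) (D X \<xi> p)"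
    using X Y by (simp add: g_commute)
  then show "curvature D' X Y \<xi>' p u = ((\<lambda>p. 1 / \<beta> p) *\<^sub>F curvature D X Y \<xi>
    + (\<lambda>p. \<xi> p \<beta> / (\<beta> p)\<^sup>2) *\<^sub>F (app1 \<eta> Y *\<^sub>F D X \<xi> - app1 \<eta> X *\<^sub>F D Y \<xi>)) p u"
    using X Y by (simp add: curvature_def D'_xi' vfields_lie_bracket leibniz app1_def)
      (simp add: field_simps)
qed

text \<open>The extra terms of \<open>L\<^bsub>f \<xi>\<^esub> \<phi>\<close> are multiples of \<open>\<phi> \<xi>\<close> and of \<open>(\<phi> X) f\<close>; the latter vanishes for \<open>f = 1 / \<beta>\<close>
  as \<open>df\<close> is proportional to \<open>\<eta>\<close>.\<close>

lemma h_xi':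
  assumes X: "X \<in> vfields A"
  shows "h_op \<phi> \<xi>' X = (\<lambda>p. 1 / \<beta> p) *\<^sub>F h X"
proof (intro ext)
  fix p u
  have "deriv_along (appE \<phi> X) (\<lambda>q. 1 / \<beta> q) p = 0"
    using tangent_inverse[OF vfields_tangent[OF phi_vfield[OF X]] beta_smooth beta_neq_0, of p]
      beta_tangent[OF vfields_tangent[OF phi_vfield[OF X]], of p] X
    by (simp add: deriv_along_def)
  then show "h_op \<phi> \<xi>' X p u = ((\<lambda>p. 1 / \<beta> p) *\<^sub>F h X) p u"
    using X unfolding h_op_def lie_deriv_endo_def deform_xi_def
    by (simp add: lie_bracket_fscale_left inverse_beta_smooth phi_linear vfields_lie_bracket algebra_simps)
qed

lemma R_class_eta': "R_class A \<eta>' = R_class A \<eta>"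
proof -
  have "wedge11 (d0 f) \<eta>' p v w = \<beta> p * wedge11 (d0 f) \<eta> p v w" for f p v w
    by (simp add: wedge11_def deform_eta_def algebra_simps)
  then show ?thesis
    by (simp add: R_class_def)
qed

text \<open>The multiple of \<open>\<nabla> \<xi> = \<alpha> \<phi>\<^sup>2 + \<phi> h\<close> that the derivative of \<open>1 / \<beta>\<close> leaves in the curvature has the shape of \<open>B\<close>;
  its two summands are what is added to \<open>\<kappa>\<close> and \<open>\<nu>\<close>.\<close>

lemma kmn':
  assumes alpha: "\<alpha> \<in> R_class A \<eta>" and kmn: "\<kappa> \<in> R_class A \<eta>" "\<mu> \<in> R_class A \<eta>" "\<nu> \<in> R_class A \<eta>"
    and R: "\<And>X Y. X \<in> vfields A \<Longrightarrow> Y \<in> vfields A \<Longrightarrow> curvature D X Y \<xi> =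
      app1 \<eta> Y *\<^sub>F B_op \<phi> \<xi> \<kappa> \<mu> \<nu> X - app1 \<eta> X *\<^sub>F B_op \<phi> \<xi> \<kappa> \<mu> \<nu> Y"
  defines "\<kappa>' \<equiv> \<lambda>p. \<kappa> p / (\<beta> p)^2 + \<alpha> p / (\<beta> p)^3 * app1 (d0 \<beta>) \<xi> p"
    and "\<mu>' \<equiv> \<lambda>p. \<mu> p / \<beta> p"
    and "\<nu>' \<equiv> \<lambda>p. \<nu> p / \<beta> p + app1 (d0 \<beta>) \<xi> p / (\<beta> p)^2"
  shows "kmn_structure A \<phi> \<xi>' \<eta>' g' \<kappa>' \<mu>' \<nu>'"
  unfolding kmn_structure_def R_class_eta'
proof (intro conjI exI[of _ D'] ballI)
  have i: "(\<lambda>p. 1 / \<beta> p) \<in> R_class A \<eta>"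
    by (rule R_class_inverse[OF beta_R_class beta_neq_0])
  have b: "(\<lambda>p. \<xi> p \<beta>) \<in> R_class A \<eta>"
    by (rule R_class_xi[OF beta_R_class eta_closed])
  note i2 = R_class_mult[OF i i] and closure = R_class_mult R_class_add
  have "(\<lambda>p. \<kappa> p * (1 / \<beta> p * (1 / \<beta> p)) + \<alpha> p * (1 / \<beta> p * (1 / \<beta> p) * (1 / \<beta> p)) * \<xi> p \<beta>) \<in> R_class A \<eta>"
    by (intro closure i b kmn alpha)
  moreover have "\<kappa>' = (\<lambda>p. \<kappa> p * (1 / \<beta> p * (1 / \<beta> p)) + \<alpha> p * (1 / \<beta> p * (1 / \<beta> p) * (1 / \<beta> p)) * \<xi> p \<beta>)"
    by (simp add: \<kappa>'_def app1_def d0_def power2_eq_square power3_eq_cube)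
  ultimately show "\<kappa>' \<in> R_class A \<eta>"
    by simp
  have "(\<lambda>p. \<mu> p * (1 / \<beta> p)) \<in> R_class A \<eta>"
    by (intro closure i kmn)
  then show "\<mu>' \<in> R_class A \<eta>"
    by (simp add: \<mu>'_def)
  have "(\<lambda>p. \<nu> p * (1 / \<beta> p) + \<xi> p \<beta> * (1 / \<beta> p * (1 / \<beta> p))) \<in> R_class A \<eta>"
    by (intro closure i b kmn)
  moreover have "\<nu>' = (\<lambda>p. \<nu> p * (1 / \<beta> p) + \<xi> p \<beta> * (1 / \<beta> p * (1 / \<beta> p)))"
    by (simp add: \<nu>'_def app1_def d0_def power2_eq_square)
  ultimately show "\<nu>' \<in> R_class A \<eta>"
    by simp
  show "levi_civita A g' D'"
    by (rule levi_civita_D')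
  fix X Y assume X: "X \<in> vfields A" and Y: "Y \<in> vfields A"
  have B': "\<beta> p * B_op \<phi> \<xi>' \<kappa>' \<mu>' \<nu>' Z p u = B_op \<phi> \<xi> \<kappa> \<mu> \<nu> Z p u / \<beta> p + \<xi> p \<beta> / (\<beta> p)\<^sup>2 * D Z \<xi> p u"
    if Z: "Z \<in> vfields A" for Z p u
    using Z by (simp add: B_op_def h_xi' D_xi phi_linear \<kappa>'_def \<mu>'_def \<nu>'_def app1_def d0_def)
      (simp add: field_simps power2_eq_square power3_eq_cube)
  show "curvature D' X Y \<xi>' =
      app1 \<eta>' Y *\<^sub>F B_op \<phi> \<xi>' \<kappa>' \<mu>' \<nu>' X - app1 \<eta>' X *\<^sub>F B_op \<phi> \<xi>' \<kappa>' \<mu>' \<nu>' Y"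
  proof (intro ext)
    fix p u
    have "(app1 \<eta>' Y *\<^sub>F B_op \<phi> \<xi>' \<kappa>' \<mu>' \<nu>' X - app1 \<eta>' X *\<^sub>F B_op \<phi> \<xi>' \<kappa>' \<mu>' \<nu>' Y) p u
        = \<eta> p (Y p) * (\<beta> p * B_op \<phi> \<xi>' \<kappa>' \<mu>' \<nu>' X p u) - \<eta> p (X p) * (\<beta> p * B_op \<phi> \<xi>' \<kappa>' \<mu>' \<nu>' Y p u)"
      by (simp add: app1_def deform_eta_def)
    also have "\<dots> = curvature D' X Y \<xi>' p u"
      unfolding B'[OF X] B'[OF Y] curvature_D'_xi'[OF X Y] R[OF X Y]
      by (simp add: app1_def algebra_simps diff_divide_distrib)
    finally show "curvature D' X Y \<xi>' p u = (app1 \<eta>' Y *\<^sub>F B_op \<phi> \<xi>' \<kappa>' \<mu>' \<nu>' X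
        - app1 \<eta>' X *\<^sub>F B_op \<phi> \<xi>' \<kappa>' \<mu>' \<nu>' Y) p u" ..
  qed
qed

end

theorem proposition11:
  fixes A :: "('a::{t2_space,second_countable_topology}, 'e::euclidean_space) atlas"
    and n :: nat and \<alpha> \<kappa> \<mu> \<nu> \<beta> :: "'a \<Rightarrow> real" and \<gamma> :: real
    and \<phi> :: "'a endo" and \<xi> :: "'a vfield" and \<eta> :: "'a oneform" and g :: "'a bilin"
  defines "\<xi>' \<equiv> deform_xi \<beta> \<xi>"
    and "\<eta>' \<equiv> deform_eta \<beta> \<eta>"
    and "g' \<equiv> deform_g \<gamma> \<beta> \<eta> g"
    and "\<kappa>' \<equiv> (\<lambda>p. \<kappa> p / (\<beta> p)^2 + \<alpha> p / (\<beta> p)^3 * app1 (d0 \<beta>) \<xi> p)"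
    and "\<mu>' \<equiv> (\<lambda>p. \<mu> p / \<beta> p)"
    and "\<nu>' \<equiv> (\<lambda>p. \<nu> p / \<beta> p + app1 (d0 \<beta>) \<xi> p / (\<beta> p)^2)"
  assumes "smooth_atlas A"
    and "almost_para_kenmotsu A n \<alpha> \<phi> \<xi> \<eta> g"
    and "kmn_structure A \<phi> \<xi> \<eta> g \<kappa> \<mu> \<nu>"
    and "\<gamma> > 0"
    and "\<beta> \<in> R_class A \<eta>"
    and "\<forall>p. \<beta> p \<noteq> 0"
  shows "almost_paracosymplectic A n (\<lambda>p. \<alpha> p / \<beta> p) \<phi> \<xi>' \<eta>' g' \<and>
         kmn_structure A \<phi> \<xi>' \<eta>' g' \<kappa>' \<mu>' \<nu>' \<and>
         \<kappa>' \<in> R_class A \<eta>' \<and> \<mu>' \<in> R_class A \<eta>' \<and> \<nu>' \<in> R_class A \<eta>'"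
proof -
  from assms(9) obtain D where kmn: "\<kappa> \<in> R_class A \<eta>" "\<mu> \<in> R_class A \<eta>" "\<nu> \<in> R_class A \<eta>"
    and D: "levi_civita A g D"
    and R: "\<And>X Y. X \<in> vfields A \<Longrightarrow> Y \<in> vfields A \<Longrightarrow> curvature D X Y \<xi> =
      app1 \<eta> Y *\<^sub>F B_op \<phi> \<xi> \<kappa> \<mu> \<nu> X - app1 \<eta> X *\<^sub>F B_op \<phi> \<xi> \<kappa> \<mu> \<nu> Y"
    unfolding kmn_structure_def by blast
  from assms(8) obtain c where pcs: "almost_paracosymplectic A n \<alpha> \<phi> \<xi> \<eta> g" and "\<forall>p. \<alpha> p = c"
    unfolding almost_para_kenmotsu_def by blast
  then have c: "\<alpha> = (\<lambda>_. c)"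
    by blast
  interpret deformation A n \<phi> \<xi> \<eta> g \<alpha> D \<gamma> \<beta>
    by unfold_locales (use assms(7,10,11,12) pcs D in \<open>simp_all add: almost_paracosymplectic_def\<close>)
  have "kmn_structure A \<phi> \<xi>' \<eta>' g' \<kappa>' \<mu>' \<nu>'"
    unfolding assms(1-6) using kmn'[OF _ kmn R] R_class_const[of c] c by simp
  moreover have "almost_paracosymplectic A n (\<lambda>p. \<alpha> p / \<beta> p) \<phi> \<xi>' \<eta>' g'"
    unfolding assms(1-3) by (rule paracosymplectic')
  ultimately show ?thesis
    unfolding kmn_structure_def by blast
qed

end
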